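(* Let $f,g\in\mathcal C^2(\mathbb R)$ and $\underline u\in\mathbb R$ be such that $g(\underline u)=0$, $g'(\underline u)<0$ and $f''(\underline u)\neq0$. Then for any $C_0>1$ there exists $\epsilon>0$ such that for any $v_0\in BUC^1(\mathbb R)$ satisfying $$\|v_0\|_{L^\infty(\mathbb R)}\le\epsilon\quad\text{and}\quad\|(\operatorname{sgn}(f''(\underline u))\,\partial_xv_0)_-\|_{L^\infty(\mathbb R)}\le\epsilon,$$ the initial data $u|_{t=0}=\underline u+v_0$ generates a global unique classical solution $u\in BUC^1([0,\infty)\times\mathbb R)$ to $\partial_tu+\partial_x(f(u))=g(u)$, and it satisfies for any $t\ge0$ $$\|u(t,\cdot)-\underline u\|_{L^\infty(\mathbb R)}\le\|v_0\|_{L^\infty(\mathbb R)}\,C_0\,e^{g'(\underline u)t},$$ $$\|(\operatorname{sgn}(f''(\underline u))\,\partial_xu(t,\cdot))_-\|_{L^\infty(\mathbb R)}\le\|(\operatorname{sgn}(f''(\underline u))\,\partial_xv_0)_-\|_{L^\infty(\mathbb R)}\,C_0\,e^{g'(\underline u)t},$$ $$\|\partial_xu(t,\cdot)\|_{L^\infty(\mathbb R)}\le\|\partial_xv_0\|_{L^\infty(\mathbb R)}\,C_0\,e^{g'(\underline u)t}.$$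
   Context: $BUC^k$ denotes the set of $\mathcal C^k$ functions whose derivatives up to order $k$ are bounded and uniformly continuous. $(a)_-=\max(-a,0)$ is the negative part and $\operatorname{sgn}$ the sign. *)

theory Defs
  imports "HOL-Analysis.Analysis" "HOL-Probability.Essential_Supremum"
begin

text \<open>
  The norm takes values in \<^typ>\<open>ereal\<close>, so that an unbounded (or non-measurable) function has
  norm \<^term>\<open>\<infinity>::ereal\<close>.
\<close>

definition Linf_norm :: "(real \<Rightarrow> real) \<Rightarrow> ereal" where
  "Linf_norm h = esssup lborel (\<lambda>x. ereal \<bar>h x\<bar>)"

definition neg_part :: "real \<Rightarrow> real" where
  "neg_part a = max (- a) 0"

definition C2 :: "(real \<Rightarrow> real) \<Rightarrow> bool" where
  "C2 h \<longleftrightarrow> h C1_differentiable_on UNIV \<and> deriv h C1_differentiable_on UNIV"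

text \<open>
  Derivatives are taken within \<open>S\<close>; on a set with boundary such as the closed half-plane
  \<open>{0..} \<times> UNIV\<close> they are one-sided at the boundary, and values outside \<open>S\<close> are irrelevant.
  Bounding the Frechet derivative in operator norm amounts to bounding
  all first-order partial derivatives, and likewise for uniform continuity.
\<close>

definition BUC1 :: "'a::real_normed_vector set \<Rightarrow> ('a \<Rightarrow> real) \<Rightarrow> bool" where
  "BUC1 S h \<longleftrightarrow>
     bounded (h ` S) \<and> uniformly_continuous_on S h \<and>
     (\<exists>D :: 'a \<Rightarrow> 'a \<Rightarrow>\<^sub>L real.
        (\<forall>z\<in>S. (h has_derivative blinfun_apply (D z)) (at z within S)) \<and>
        bounded (D ` S) \<and> uniformly_continuous_on S D)"

text \<open>
  Global solutions in \<open>BUC1([0,\<infinity>) \<times> \<real>)\<close> of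
  \<open>\<partial>\<^sub>t u + \<partial>\<^sub>x (f(u)) = g(u)\<close> with initial data \<open>u0\<close>;
  the first argument of \<open>u\<close> is time.
\<close>

definition global_classical_solution ::
  "(real \<Rightarrow> real) \<Rightarrow> (real \<Rightarrow> real) \<Rightarrow> (real \<Rightarrow> real) \<Rightarrow> (real \<Rightarrow> real \<Rightarrow> real) \<Rightarrow> bool" where
  "global_classical_solution f g u0 u \<longleftrightarrow>
     BUC1 ({0..} \<times> UNIV) (\<lambda>(t, x). u t x) \<and>
     (\<forall>x. u 0 x = u0 x) \<and>
     (\<forall>t\<ge>0. \<forall>x. \<exists>ut fx.
        ((\<lambda>s. u s x) has_real_derivative ut) (at t within {0..}) \<and>
        ((\<lambda>y. f (u t y)) has_real_derivative fx) (at x) \<and>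
        ut + fx = g (u t x))"

end

theory Submission
  imports Defs
begin

text \<open>
  Write \<open>u = ubar + v\<close> and \<open>\<lambda> = g'(ubar) < 0\<close>. Along a characteristic \<open>Z' = f'(U)\<close>, \<open>U' = g(U)\<close> the source
  acts as a scalar autonomous equation with an attracting hyperbolic zero. Such an equation can be
  linearized: as \<open>g\<close> is \<open>C\<^sup>2\<close>, \<open>g(ubar + s) = s (\<lambda> + s r(s))\<close> with \<open>r\<close> continuous, and
  \<open>\<psi>(s) = s exp (- \<integral> r / (\<lambda> + s r))\<close> is a \<open>C\<^sup>1\<close> coordinate with \<open>g(ubar + s) \<psi>'(s) = \<lambda> \<psi>(s)\<close> near \<open>0\<close> and
  \<open>\<psi>'(0) = 1\<close> (\<open>linearizing_coordinate\<close>). In the unknown \<open>w = \<psi>(v)\<close> the balance law reads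
  \<open>\<partial>\<^sub>t w + F(w) \<partial>\<^sub>x w = \<lambda> w\<close>, so \<open>w\<close> decays exactly like \<open>exp (\<lambda> t)\<close> along characteristics, and the
  characteristic from \<open>y\<close> is the explicit curve \<open>X t y = y + \<integral> F (exp (\<lambda> s) w0(y)) ds\<close>, the integral
  running over \<open>0 \<le> s \<le> t\<close>.

  Everything rests on the Jacobian \<open>X_y = 1 + h w0'(y)\<close>. The decay makes \<open>h\<close> bounded uniformly in
  time, and \<open>h\<close> has the sign of \<open>F'\<close>, which is the sign of \<open>f''(ubar)\<close>. Where the signed slope of the data is
  nonnegative, characteristics spread; where it is negative it is small, so \<open>X_y\<close> stays above a
  constant \<open>1 - \<theta>\<close> close to \<open>1\<close> (\<open>X_y_ge\<close>). Hence \<open>X t\<close> is a diffeomorphism of the line for every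
  \<open>t \<ge> 0\<close>, its inverse \<open>Y\<close> is Lipschitz in both variables, and \<open>exp (\<lambda> t) w0(Y t x)\<close> is a global solution.
  Its derivatives are combinations of continuous functions of bounded uniformly continuous ones,
  which gives the regularity up to infinite time.

  At a point \<open>(t, x)\<close> with foot \<open>y = Y t x\<close>, both \<open>|v(t, x)|\<close> and \<open>\<partial>\<^sub>x v(t, x)\<close> are controlled by the data at
  the same foot: \<open>|v(t, x)| \<le> \<kappa>\<^sup>2 exp (\<lambda> t) |v0(y)|\<close>, where \<open>\<kappa>\<close> bounds \<open>\<psi>'\<close> and \<open>1 / \<psi>'\<close>, and
  \<open>\<partial>\<^sub>x v(t, x) = c v0'(y)\<close> with \<open>0 \<le> c \<le> \<kappa>\<^sup>2 exp (\<lambda> t) / (1 - \<theta>)\<close>. Choosing \<open>1 - \<theta> = 1 / \<kappa>\<close> and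
  \<open>\<kappa>\<^sup>3 = C0\<close>, the three norm estimates, including the one for the negative part, follow at once.

  For uniqueness, the characteristics of the constructed solution are used to test any other
  classical solution \<open>w\<close>: the difference \<open>w(t, Z(t)) - U(t)\<close> satisfies a linear differential inequality
  and starts from \<open>0\<close> (\<open>classical_solution_on_characteristic\<close>). As the curves \<open>Z\<close> cover the half-plane,
  \<open>w\<close> and the constructed solution coincide.
\<close>

section \<open>Bounded uniformly continuous functions and essential suprema\<close>

text \<open>
  The class \<open>BUC\<^sup>0\<close>. It is closed under pairing, under composition with continuous functions and
  under uniformly continuous changes of variables; these closure properties give the regularity of
  the solution.
\<close>

definition buc :: "'a::metric_space set \<Rightarrow> ('a \<Rightarrow> 'b::real_normed_vector) \<Rightarrow> bool" where
  "buc S h \<longleftrightarrow> bounded (h ` S) \<and> uniformly_continuous_on S h"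

lemma uniformly_continuous_on_subset:
  fixes h :: "'a::metric_space \<Rightarrow> 'b::metric_space"
  assumes "uniformly_continuous_on T h" and "S \<subseteq> T"
  shows "uniformly_continuous_on S h"
  using assms unfolding uniformly_continuous_on_def by (meson subset_iff)

lemma buc_const: "buc S (\<lambda>_. c)"
proof -
  have "bounded ((\<lambda>_. c) ` S)"
    by (rule bounded_subset[of "{c}"]) auto
  then show ?thesis
    by (simp add: buc_def uniformly_continuous_on_const)
qed

text \<open>
  The image of \<open>h\<close> has compact closure, where the outer function is uniformly continuous. The closed set
  \<open>K\<close> allows outer functions with singularities that \<open>h\<close> avoids, such as the inverse.
\<close>

lemma buc_compose_closed:
  fixes h :: "'a::metric_space \<Rightarrow> 'b::euclidean_space"
  assumes h: "buc S h" and K: "closed K" "h ` S \<subseteq> K" and \<phi>: "continuous_on K \<phi>"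
  shows "buc S (\<lambda>x. \<phi> (h x))"
proof -
  let ?C = "closure (h ` S)"
  have C: "compact ?C" "?C \<subseteq> K"
    using h K by (auto simp: buc_def closure_minimal)
  have cont: "continuous_on ?C \<phi>"
    using \<phi> C(2) continuous_on_subset by blast
  have uc: "uniformly_continuous_on ?C \<phi>"
    by (rule compact_uniformly_continuous[OF cont C(1)])
  have "bounded (\<phi> ` ?C)"
    using compact_continuous_image[OF cont C(1)] compact_imp_bounded by blast
  moreover have "(\<lambda>x. \<phi> (h x)) ` S \<subseteq> \<phi> ` ?C"
    using closure_subset[of "h ` S"] by auto
  ultimately have "bounded ((\<lambda>x. \<phi> (h x)) ` S)"
    using bounded_subset by blast
  moreover have "uniformly_continuous_on S (\<lambda>x. \<phi> (h x))"
  proof (rule uniformly_continuous_on_compose[of S h \<phi>, unfolded o_def])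
    show "uniformly_continuous_on S h" using h by (simp add: buc_def)
    show "uniformly_continuous_on (h ` S) \<phi>"
      by (rule uniformly_continuous_on_subset[OF uc closure_subset])
  qed
  ultimately show ?thesis by (simp add: buc_def)
qed

lemma buc_compose:
  fixes h :: "'a::metric_space \<Rightarrow> 'b::euclidean_space"
  assumes "buc S h" and "continuous_on UNIV \<phi>"
  shows "buc S (\<lambda>x. \<phi> (h x))"
  using buc_compose_closed[OF assms(1) closed_UNIV _ assms(2)] by simp

lemma buc_reparametrize:
  assumes "buc T \<phi>" and "uniformly_continuous_on S h" and "h ` S \<subseteq> T"
  shows "buc S (\<lambda>x. \<phi> (h x))"
proof -
  have "bounded ((\<lambda>x. \<phi> (h x)) ` S)"
    by (rule bounded_subset[of "\<phi> ` T"]) (use assms in \<open>auto simp: buc_def\<close>)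
  moreover have "uniformly_continuous_on (h ` S) \<phi>"
    using assms(1,3) uniformly_continuous_on_subset by (auto simp: buc_def)
  ultimately show ?thesis
    using uniformly_continuous_on_compose[of S h \<phi>] assms(2) by (simp add: buc_def o_def)
qed

lemma buc_Pair:
  assumes "buc S h" and "buc S k"
  shows "buc S (\<lambda>x. (h x, k x))"
proof -
  have "bounded ((\<lambda>x. (h x, k x)) ` S)"
    by (rule bounded_subset[of "h ` S \<times> k ` S"])
      (use assms in \<open>auto simp: buc_def intro: bounded_Times\<close>)
  moreover have "uniformly_continuous_on S (\<lambda>x. (h x, k x))"
    unfolding uniformly_continuous_on_def
  proof (intro allI impI)
    fix e :: real assume e: "e > 0"
    obtain d1 where d1: "d1 > 0" "\<And>x y. x \<in> S \<Longrightarrow> y \<in> S \<Longrightarrow> dist y x < d1 \<Longrightarrow> dist (h y) (h x) < e/2"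
      using assms(1) e unfolding buc_def uniformly_continuous_on_def by (meson half_gt_zero)
    obtain d2 where d2: "d2 > 0" "\<And>x y. x \<in> S \<Longrightarrow> y \<in> S \<Longrightarrow> dist y x < d2 \<Longrightarrow> dist (k y) (k x) < e/2"
      using assms(2) e unfolding buc_def uniformly_continuous_on_def by (meson half_gt_zero)
    have "dist (h y, k y) (h x, k x) < e"
      if "x \<in> S" "y \<in> S" "dist y x < min d1 d2" for x y
    proof -
      have "dist (h y, k y) (h x, k x) \<le> dist (h y) (h x) + dist (k y) (k x)"
        unfolding dist_Pair_Pair by (rule sqrt_sum_squares_le_sum) auto
      also have "\<dots> < e" using d1(2)[of x y] d2(2)[of x y] that by auto
      finally show ?thesis .
    qed
    then show "\<exists>d>0. \<forall>x\<in>S. \<forall>y\<in>S. dist y x < d \<longrightarrow> dist (h y, k y) (h x, k x) < e"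
      using d1(1) d2(1) by (intro exI[of _ "min d1 d2"]) auto
  qed
  ultimately show ?thesis by (simp add: buc_def)
qed

lemma buc_mult:
  fixes h k :: "'a::metric_space \<Rightarrow> real"
  assumes "buc S h" and "buc S k"
  shows "buc S (\<lambda>x. h x * k x)"
  using buc_compose[OF buc_Pair[OF assms], of "\<lambda>p. fst p * snd p"]
  by (simp add: continuous_intros)

lemma buc_add:
  fixes h k :: "'a::metric_space \<Rightarrow> real"
  assumes "buc S h" and "buc S k"
  shows "buc S (\<lambda>x. h x + k x)"
  using buc_compose[OF buc_Pair[OF assms], of "\<lambda>p. fst p + snd p"]
  by (simp add: continuous_intros)

lemma buc_diff:
  fixes h k :: "'a::metric_space \<Rightarrow> real"
  assumes "buc S h" and "buc S k"
  shows "buc S (\<lambda>x. h x - k x)"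
  using buc_compose[OF buc_Pair[OF assms], of "\<lambda>p. fst p - snd p"]
  by (simp add: continuous_intros)

lemma buc_divide:
  fixes h k :: "'a::metric_space \<Rightarrow> real"
  assumes "buc S h" and "buc S k" and c: "c > 0" "\<And>x. x \<in> S \<Longrightarrow> c \<le> k x"
  shows "buc S (\<lambda>x. h x / k x)"
proof -
  have "buc S (\<lambda>x. inverse (k x))"
    by (rule buc_compose_closed[OF assms(2), of "{c..}"])
      (use c in \<open>auto intro!: continuous_intros\<close>)
  from buc_mult[OF assms(1) this] show ?thesis
    by (simp add: divide_inverse)
qed

lemma buc_compose_linear:
  assumes "buc S h" and "bounded_linear A"
  shows "buc S (\<lambda>x. A (h x))"
proof -
  have "bounded (A ` (h ` S))"
    by (rule bounded_linear_image) (use assms in \<open>auto simp: buc_def\<close>)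
  then show ?thesis
    using bounded_linear.uniformly_continuous_on[OF assms(2), of S h] assms(1)
    by (simp add: buc_def image_image)
qed

text \<open>
  The Frechet derivative depends linearly on the two partial derivatives, so it inherits their
  boundedness and uniform continuity.
\<close>

lemma BUC1_planeI:
  fixes u ut ux :: "real \<times> real \<Rightarrow> real"
  assumes "buc S u" "buc S ut" "buc S ux"
    and "\<And>z. z \<in> S \<Longrightarrow> (u has_derivative (\<lambda>d. ut z * fst d + ux z * snd d)) (at z within S)"
  shows "BUC1 S u"
proof -
  define D where "D = (\<lambda>z. ut z *\<^sub>R (fst_blinfun :: (real \<times> real) \<Rightarrow>\<^sub>L real) + ux z *\<^sub>R snd_blinfun)"
  have "buc S (\<lambda>z. (\<lambda>p. fst p *\<^sub>R (fst_blinfun :: (real \<times> real) \<Rightarrow>\<^sub>L real) + snd p *\<^sub>R snd_blinfun) (ut z, ux z))"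
    by (rule buc_compose[OF buc_Pair[OF assms(2,3)]]) (intro continuous_intros)
  then have "buc S D" by (simp add: D_def)
  moreover have "blinfun_apply (D z) = (\<lambda>d. ut z * fst d + ux z * snd d)" for z
    by (auto simp: D_def blinfun.add_left blinfun.scaleR_left)
  ultimately show ?thesis
    using assms(1,4) unfolding BUC1_def buc_def by (intro conjI exI[of _ D]) auto
qed

lemma BUC1_UNIV_derivative:
  assumes "BUC1 UNIV (h :: real \<Rightarrow> real)"
  shows "(h has_real_derivative deriv h x) (at x)" and "buc UNIV (deriv h)"
proof -
  have "\<exists>D :: real \<Rightarrow> real \<Rightarrow>\<^sub>L real. (\<forall>x. (h has_derivative blinfun_apply (D x)) (at x)) \<and> buc UNIV D"
    using assms by (simp add: BUC1_def buc_def)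
  then obtain D :: "real \<Rightarrow> real \<Rightarrow>\<^sub>L real"
    where D: "\<forall>x. (h has_derivative blinfun_apply (D x)) (at x)" "buc UNIV D"
    by (elim exE conjE) (rule that)
  have lin: "blinfun_apply (D x) = (*) (D x 1)" for x
  proof
    fix e
    have "D x (e *\<^sub>R 1) = e *\<^sub>R D x 1" by (rule blinfun.scaleR_right)
    then show "D x e = D x 1 * e" by (simp only: real_scaleR_def mult_1_right mult_1_left mult.commute)
  qed
  have der: "(h has_real_derivative D x 1) (at x)" for x
    unfolding has_field_derivative_def lin[symmetric] by (rule D(1)[rule_format])
  then have eq: "deriv h = (\<lambda>x. D x 1)" by (intro ext DERIV_imp_deriv)
  then show "(h has_real_derivative deriv h x) (at x)" using der by simp
  show "buc UNIV (deriv h)"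
    unfolding eq by (rule buc_compose_linear[OF D(2) blinfun.bounded_linear_left])
qed

text \<open>
  For a continuous function the essential supremum is a true supremum: a bound that fails at
  one point fails on a nonempty open set, which is not negligible.
\<close>

lemma Linf_norm_le_iff:
  fixes h :: "real \<Rightarrow> real"
  assumes "continuous_on UNIV h"
  shows "Linf_norm h \<le> c \<longleftrightarrow> (\<forall>x. ereal \<bar>h x\<bar> \<le> c)"
proof
  have meas: "(\<lambda>x. ereal \<bar>h x\<bar>) \<in> borel_measurable lborel"
    using borel_measurable_continuous_onI[OF assms] by simp
  show "Linf_norm h \<le> c" if "\<forall>x. ereal \<bar>h x\<bar> \<le> c"
    unfolding Linf_norm_def by (rule esssup_I[OF meas]) (use that in auto)
  show "\<forall>x. ereal \<bar>h x\<bar> \<le> c" if "Linf_norm h \<le> c"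
  proof (rule ccontr)
    assume "\<not> (\<forall>x. ereal \<bar>h x\<bar> \<le> c)"
    then have ne: "{x. c < ereal \<bar>h x\<bar>} \<noteq> {}" by (auto simp: not_le)
    have op: "open {x. c < ereal \<bar>h x\<bar>}"
      by (intro open_Collect_less continuous_on_ereal continuous_intros assms)
    have "AE x in lborel. x \<notin> {x. c < ereal \<bar>h x\<bar>}"
      using esssup_AE[of "\<lambda>x. ereal \<bar>h x\<bar>" lborel] that
      by (auto simp: Linf_norm_def not_less elim!: eventually_mono)
    then have "{x. c < ereal \<bar>h x\<bar>} \<in> null_sets lborel"
      by (subst AE_iff_null_sets) (use op in auto)
    then have "negligible {x. c < ereal \<bar>h x\<bar>}"
      by (simp add: negligible_iff_null_sets null_sets_completionI)
    then show False using open_not_negligible[OF op ne] by simp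
  qed
qed

text \<open>
  The form in which pointwise information along characteristics becomes a norm estimate: the value
  at \<open>x\<close> is compared with the value of the other function at the foot \<open>y\<close>.
\<close>

lemma Linf_norm_le_multiple:
  fixes h k :: "real \<Rightarrow> real"
  assumes h: "continuous_on UNIV h" and k: "continuous_on UNIV k" and c: "0 \<le> c"
    and le: "\<And>x. \<exists>y. \<bar>h x\<bar> \<le> c * \<bar>k y\<bar>"
  shows "Linf_norm h \<le> Linf_norm k * ereal c"
  unfolding Linf_norm_le_iff[OF h]
proof
  fix x
  obtain y where y: "\<bar>h x\<bar> \<le> c * \<bar>k y\<bar>" using le by blast
  have "ereal \<bar>k y\<bar> \<le> Linf_norm k" using Linf_norm_le_iff[OF k, of "Linf_norm k"] by simp
  then have "ereal \<bar>k y\<bar> * ereal c \<le> Linf_norm k * ereal c"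
    using c by (intro ereal_mult_right_mono) auto
  moreover have "ereal \<bar>h x\<bar> \<le> ereal \<bar>k y\<bar> * ereal c" using y by (simp add: mult.commute)
  ultimately show "ereal \<bar>h x\<bar> \<le> Linf_norm k * ereal c" by order
qed

section \<open>Calculus on the line\<close>

lemma uniformly_continuous_on_bounded_derivative:
  fixes h h' :: "real \<Rightarrow> real"
  assumes "convex S" and "\<And>x. x \<in> S \<Longrightarrow> (h has_real_derivative h' x) (at x within S)"
    and "bounded (h' ` S)"
  shows "uniformly_continuous_on S h"
proof -
  obtain B where B: "\<And>x. x \<in> S \<Longrightarrow> \<bar>h' x\<bar> \<le> B"
    using assms(3) by (auto simp: bounded_iff)
  have "\<bar>B\<bar>-lipschitz_on S h"
  proof (rule bounded_derivative_imp_lipschitz[OF _ assms(1)])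
    fix x assume "x \<in> S"
    then show "(h has_derivative (*) (h' x)) (at x within S)"
      using assms(2) by (simp add: has_field_derivative_def)
    show "onorm ((*) (h' x)) \<le> \<bar>B\<bar>"
      by (rule onorm_le) (use B[OF \<open>x \<in> S\<close>] in \<open>auto simp: abs_mult intro!: mult_right_mono\<close>)
  qed auto
  then show ?thesis by (rule lipschitz_on_uniformly_continuous)
qed

lemma antiderivative_exists:
  fixes h :: "real \<Rightarrow> real"
  assumes "continuous_on UNIV h"
  shows "\<exists>G. G c = a \<and> (\<forall>x. (G has_real_derivative h x) (at x))"
proof -
  have "\<exists>G. \<forall>x::real. -\<infinity> < ereal x \<longrightarrow> ereal x < \<infinity> \<longrightarrow> (G has_vector_derivative h x) (at x)"
    by (rule einterval_antiderivative) (use assms in \<open>auto simp: continuous_on_eq_continuous_at\<close>)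
  then obtain G where G: "\<And>x. (G has_real_derivative h x) (at x)"
    by (auto simp: has_real_derivative_iff_has_vector_derivative)
  have "((\<lambda>x. G x - G c + a) has_real_derivative h x) (at x)" for x
    by (auto intro!: derivative_eq_intros G)
  then show ?thesis by (intro exI[of _ "\<lambda>x. G x - G c + a"]) simp
qed

lemma continuous_on_difference_quotient:
  fixes h :: "real \<Rightarrow> real"
  assumes "\<And>x. (h has_real_derivative h' x) (at x)"
  shows "continuous_on UNIV (\<lambda>x. if x = 0 then h' 0 else (h x - h 0) / x)"
    (is "continuous_on UNIV ?q")
proof -
  have "isCont ?q x" for x
  proof (cases "x = 0")
    case True
    have "((\<lambda>x. (h x - h 0) / (x - 0)) \<longlongrightarrow> h' 0) (at 0)"
      using assms[of 0] by (simp add: has_field_derivative_iff)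
    then have "(?q \<longlongrightarrow> h' 0) (at 0)"
      by (rule Lim_transform_eventually) (simp add: eventually_at_filter)
    then show ?thesis using True by (simp add: isCont_def)
  next
    case False
    have "isCont (\<lambda>x. (h x - h 0) / x) x"
      using False DERIV_isCont[OF assms[of x]] by (auto intro!: continuous_intros)
    moreover have "\<forall>\<^sub>F y in nhds x. (h y - h 0) / y = ?q y"
      using t1_space_nhds[OF False] by (rule eventually_mono) simp
    ultimately show ?thesis
      using isCont_cong by fast
  qed
  then show ?thesis by (simp add: continuous_on_eq_continuous_at)
qed

lemma growth_of_derivative_ge:
  fixes h :: "real \<Rightarrow> real"
  assumes "\<And>x. (h has_real_derivative h' x) (at x)" and "\<And>x. c \<le> h' x" and "a \<le> b"
  shows "c * (b - a) \<le> h b - h a"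
proof (cases "a = b")
  case False
  then obtain z where "h b - h a = (b - a) * h' z"
    using MVT2[of a b h h'] assms by force
  then show ?thesis
    using assms(2)[of z] assms(3) mult_right_mono[of c "h' z" "b - a"] by (simp add: mult.commute)
qed auto

lemma bij_of_derivative_ge:
  fixes h :: "real \<Rightarrow> real"
  assumes der: "\<And>x. (h has_real_derivative h' x) (at x)" and c: "c > 0" "\<And>x. c \<le> h' x"
  shows "bij h"
proof (rule bijI)
  note grow = growth_of_derivative_ge[OF der c(2)]
  show "inj h"
  proof (rule linorder_injI)
    fix a b :: real assume "a < b"
    then have "c * (b - a) > 0" using c by simp
    then show "h a \<noteq> h b" using grow[of a b] \<open>a < b\<close> by auto
  qed
  have cont: "continuous_on A h" for A
    using der DERIV_isCont continuous_at_imp_continuous_on by blast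
  show "surj h"
  proof (unfold surj_def, intro allI)
    fix y
    let ?r = "\<bar>y - h 0\<bar> / c"
    have r: "?r \<ge> 0" "c * ?r = \<bar>y - h 0\<bar>" using c by auto
    have "h (- ?r) \<le> y" using grow[of "- ?r" 0] r by auto
    moreover have "y \<le> h ?r" using grow[of 0 ?r] r by auto
    ultimately show "\<exists>x. y = h x"
      using IVT'[of h "- ?r" y ?r] cont r(1) by (auto simp del: abs_divide)
  qed
qed

lemma C2_derivatives:
  assumes "C2 h"
  shows "\<And>x. (h has_real_derivative deriv h x) (at x)"
    and "\<And>x. (deriv h has_real_derivative deriv (deriv h) x) (at x)"
    and "continuous_on UNIV (deriv (deriv h))"
proof -
  obtain D1 D2 where D: "\<And>x. (h has_vector_derivative D1 x) (at x)"
    "\<And>x. (deriv h has_vector_derivative D2 x) (at x)" "continuous_on UNIV D2"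
    using assms by (auto simp: C2_def C1_differentiable_on_def)
  have 1: "(h has_real_derivative D1 x) (at x)" "(deriv h has_real_derivative D2 x) (at x)" for x
    using D by (auto simp: has_real_derivative_iff_has_vector_derivative)
  have "deriv h = D1" "deriv (deriv h) = D2"
    using 1 DERIV_imp_deriv by blast+
  then show "\<And>x. (h has_real_derivative deriv h x) (at x)"
    "\<And>x. (deriv h has_real_derivative deriv (deriv h) x) (at x)"
    "continuous_on UNIV (deriv (deriv h))"
    using 1 D(3) by auto
qed

lemma partial_derivatives_on_halfplane:
  fixes h :: "real \<Rightarrow> real \<Rightarrow> real"
  assumes h: "((\<lambda>z. h (fst z) (snd z)) has_derivative (\<lambda>d. a * fst d + b * snd d))
      (at (t, x) within {0..} \<times> UNIV)" and t: "t \<ge> 0"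
  shows "((\<lambda>s. h s x) has_real_derivative a) (at t within {0..})"
    and "(h t has_real_derivative b) (at x)"
proof -
  have sub: "((\<lambda>s. h s x) has_derivative (\<lambda>e. a * fst (e, 0::real) + b * snd (e, 0))) (at t within {0..})"
  proof (rule has_derivative_in_compose[where f = "\<lambda>s. (s, x)" and g = "\<lambda>z. h (fst z) (snd z)", simplified fst_conv snd_conv])
    show "((\<lambda>s. (s, x)) has_derivative (\<lambda>e. (e, 0))) (at t within {0..})"
      by (auto intro!: derivative_eq_intros)
    show "((\<lambda>z. h (fst z) (snd z)) has_derivative (\<lambda>d. a * fst d + b * snd d))
      (at (t, x) within (\<lambda>s. (s, x)) ` {0..})"
      by (rule has_derivative_subset[OF h]) auto
  qed
  then show "((\<lambda>s. h s x) has_real_derivative a) (at t within {0..})"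
    by (simp add: has_field_derivative_def)
  have "((\<lambda>y. h t y) has_derivative (\<lambda>e. a * fst (0::real, e) + b * snd (0::real, e))) (at x)"
  proof (rule has_derivative_in_compose[where f = "\<lambda>y. (t, y)" and g = "\<lambda>z. h (fst z) (snd z)", simplified fst_conv snd_conv])
    show "((\<lambda>y. (t, y)) has_derivative (\<lambda>e. (0, e))) (at x)"
      by (auto intro!: derivative_eq_intros)
    show "((\<lambda>z. h (fst z) (snd z)) has_derivative (\<lambda>d. a * fst d + b * snd d))
      (at (t, x) within range (\<lambda>y. (t, y)))"
      by (rule has_derivative_subset[OF h]) (use t in auto)
  qed
  then show "(h t has_real_derivative b) (at x)"
    by (simp add: has_field_derivative_def)
qed

section \<open>A linear source: the solution along explicit characteristics\<close>

text \<open>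
  The transport equation \<open>\<partial>\<^sub>t w + F(w) \<partial>\<^sub>x w = lam w\<close> with data \<open>w0\<close>. The sign \<open>sg\<close> makes \<open>sg F\<close>
  nondecreasing. The hypothesis on \<open>w0'\<close> says that the compression rate, at most \<open>- M sg w0'\<close>,
  accumulates to at most \<open>\<theta> < 1\<close> over the effective lifetime \<open>1 / |lam|\<close> of the wave, so that
  characteristics never cross.
\<close>

locale damped_transport =
  fixes F F' w0 w0' :: "real \<Rightarrow> real" and lam M sg \<theta> :: real
  assumes lam: "lam < 0"
    and F_deriv: "\<And>w. (F has_real_derivative F' w) (at w)"
    and sg: "\<bar>sg\<bar> = 1"
    and F'_bounds: "\<And>w. 0 \<le> sg * F' w" "\<And>w. sg * F' w \<le> M"
    and w0_deriv: "\<And>y. (w0 has_real_derivative w0' y) (at y)"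
    and w0_bounded: "bounded (range w0)"
    and w0'_buc: "buc UNIV w0'"
    and w0'_lower: "\<And>y. \<theta> * lam \<le> M * (sg * w0' y)"
    and \<theta>: "0 \<le> \<theta>" "\<theta> < 1"
begin

definition slope :: "real \<Rightarrow> real" where
  "slope w = (if w = 0 then F' 0 else (F w - F 0) / w)"

lemma slope_continuous: "continuous_on UNIV slope"
  using continuous_on_difference_quotient[OF F_deriv] by (simp add: slope_def[abs_def])

lemma slope_eq: "slope w * w = F w - F 0"
  by (simp add: slope_def)

text \<open>
  The displacement \<open>\<integral> F (exp (lam s) w) ds\<close> over \<open>[0, t]\<close> can be expressed through the antiderivative \<open>P\<close> of
  \<open>slope\<close>, by the substitution \<open>r = exp (lam s) w\<close> after splitting off \<open>F 0\<close>. In this form its derivatives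
  come from the chain rule alone, and \<open>drift_w\<close> is visibly a continuous function of \<open>exp (lam t)\<close> and \<open>w\<close>,
  hence uniformly continuous on \<open>t \<ge> 0\<close> for bounded \<open>w\<close>.
\<close>

definition P :: "real \<Rightarrow> real" where
  "P = (SOME G. G 0 = 0 \<and> (\<forall>w. (G has_real_derivative slope w) (at w)))"

lemma P_deriv: "(P has_real_derivative slope w) (at w)"
  using someI_ex[OF antiderivative_exists[OF slope_continuous, of 0 0]] by (simp add: P_def)

definition drift :: "real \<Rightarrow> real \<Rightarrow> real" where
  "drift t w = F 0 * t + (P w - P (exp (lam * t) * w)) / (- lam)"

definition drift_w :: "real \<Rightarrow> real \<Rightarrow> real" where
  "drift_w t w = (slope w - exp (lam * t) * slope (exp (lam * t) * w)) / (- lam)"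

text \<open>
  For \<open>w \<noteq> 0\<close> the left-hand side is \<open>(F w - F (q w)) / w\<close>, so this is the mean value theorem; the form with
  \<open>slope\<close> covers \<open>w = 0\<close> as well. It transfers the sign and the bound of \<open>F'\<close> to \<open>drift_w\<close>.
\<close>

lemma F_secant:
  assumes "0 \<le> q" "q \<le> 1"
  shows "\<exists>z. slope w - q * slope (q * w) = (1 - q) * F' z"
proof -
  consider "w = 0" | "q = 1" | "q = 0" "w \<noteq> 0" | "w \<noteq> 0" "0 < q" "q < 1" using assms by linarith
  then show ?thesis
  proof cases
    case 1
    then show ?thesis by (intro exI[of _ 0]) (simp add: slope_def algebra_simps)
  next
    case 2 then show ?thesis by simp
  next
    case 3
    obtain z where "F w - F 0 = (w - 0) * F' z"
    proof (cases "w > 0")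
      case True then show ?thesis using MVT2[of 0 w F F'] F_deriv that by auto
    next
      case False
      then show ?thesis using MVT2[of w 0 F F'] F_deriv that 3
        by (smt (verit, best) mult_minus_left)
    qed
    then show ?thesis using 3 by (intro exI[of _ z]) (simp add: slope_def)
  next
    case 4
    obtain z where z: "F w - F (q * w) = (w - q * w) * F' z"
    proof (cases "w > 0")
      case True
      then have "q * w < w" using 4 by simp
      then show ?thesis using MVT2[of "q * w" w F F'] F_deriv that by auto
    next
      case False
      then have "w < q * w" using 4 by (simp add: mult_less_cancel_right1)
      then obtain z where "F (q * w) - F w = (q * w - w) * F' z"
        using MVT2[of w "q * w" F F'] F_deriv by auto
      then have "F w - F (q * w) = (w - q * w) * F' z" by (simp add: algebra_simps)
      then show ?thesis by (rule that)
    qed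
    have "slope w - q * slope (q * w) = (F w - F (q * w)) / w"
      using 4 by (simp add: slope_def field_simps)
    also have "\<dots> = (1 - q) * F' z"
      unfolding z using 4 by (simp add: field_simps)
    finally show ?thesis by blast
  qed
qed

lemma exp_decay: "t \<ge> 0 \<Longrightarrow> exp (lam * t) \<le> 1"
  using lam by (simp add: mult_nonpos_nonneg)

lemma drift_w_bounds:
  assumes "t \<ge> 0"
  shows "0 \<le> sg * drift_w t w" and "sg * drift_w t w \<le> M / (- lam)"
proof -
  define q where "q = exp (lam * t)"
  have q: "0 \<le> q" "q \<le> 1" using exp_decay[OF assms] by (simp_all add: q_def)
  obtain z where z: "slope w - q * slope (q * w) = (1 - q) * F' z"
    using F_secant[OF q] by blast
  have eq: "sg * drift_w t w = (1 - q) * (sg * F' z) / (- lam)"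
    using z by (simp add: drift_w_def q_def)
  have "(1 - q) * (sg * F' z) \<ge> 0" "(1 - q) * (sg * F' z) \<le> 1 * M"
    using q F'_bounds[of z] mult_nonneg_nonneg[of "1 - q" "sg * F' z"]
      mult_mono[of "1 - q" 1 "sg * F' z" M] by simp_all
  then show "0 \<le> sg * drift_w t w" "sg * drift_w t w \<le> M / (- lam)"
    unfolding eq using lam by (auto intro!: divide_nonneg_pos divide_right_mono simp del: divide_minus_right)
qed

text \<open>
  \<open>X t y\<close> is the position at time \<open>t\<close> of the characteristic that starts from \<open>y\<close>.
\<close>

definition X :: "real \<Rightarrow> real \<Rightarrow> real" where
  "X t y = y + drift t (w0 y)"

definition X_y :: "real \<Rightarrow> real \<Rightarrow> real" where
  "X_y t y = 1 + drift_w t (w0 y) * w0' y"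

lemma X_derivative:
  "((\<lambda>z. X (fst z) (snd z)) has_derivative
     (\<lambda>d. F (exp (lam * t) * w0 y) * fst d + X_y t y * snd d)) (at (t, y))"
proof -
  have w: "((\<lambda>z. w0 (snd z)) has_derivative (\<lambda>d. snd d * w0' y)) (at (t, y))"
    by (rule DERIV_compose_FDERIV) (auto intro: w0_deriv has_derivative_snd has_derivative_ident)
  have q: "((\<lambda>z. exp (lam * fst z)) has_derivative (\<lambda>d. lam * fst d * exp (lam * t))) (at (t, y))"
    by (auto intro!: derivative_eq_intros)
  have qw: "((\<lambda>z. exp (lam * fst z) * w0 (snd z)) has_derivative
      (\<lambda>d. exp (lam * t) * (snd d * w0' y) + (lam * fst d * exp (lam * t)) * w0 y)) (at (t, y))"
    using has_derivative_mult[OF q w] by simp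
  have P1: "((\<lambda>z. P (w0 (snd z))) has_derivative (\<lambda>d. (snd d * w0' y) * slope (w0 y))) (at (t, y))"
    by (rule DERIV_compose_FDERIV[OF _ w]) (simp add: P_deriv)
  have P2: "((\<lambda>z. P (exp (lam * fst z) * w0 (snd z))) has_derivative
      (\<lambda>d. (exp (lam * t) * (snd d * w0' y) + (lam * fst d * exp (lam * t)) * w0 y)
            * slope (exp (lam * t) * w0 y))) (at (t, y))"
    by (rule DERIV_compose_FDERIV[OF _ qw]) (simp add: P_deriv)
  have "((\<lambda>z. X (fst z) (snd z)) has_derivative
      (\<lambda>d. snd d + (F 0 * fst d + ((snd d * w0' y) * slope (w0 y) -
         (exp (lam * t) * (snd d * w0' y) + (lam * fst d * exp (lam * t)) * w0 y)
            * slope (exp (lam * t) * w0 y)) / (- lam)))) (at (t, y))"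
    unfolding X_def drift_def using lam
    by (auto intro!: derivative_eq_intros P1 P2)
  moreover have "snd d + (F 0 * fst d + ((snd d * w0' y) * slope (w0 y) -
         (exp (lam * t) * (snd d * w0' y) + (lam * fst d * exp (lam * t)) * w0 y)
            * slope (exp (lam * t) * w0 y)) / (- lam))
      = F (exp (lam * t) * w0 y) * fst d + X_y t y * snd d" for d :: "real \<times> real"
  proof -
    have F: "F (exp (lam * t) * w0 y) = F 0 + slope (exp (lam * t) * w0 y) * (exp (lam * t) * w0 y)"
      using slope_eq by simp
    show ?thesis
      unfolding F X_y_def drift_w_def using lam by (simp add: field_simps)
  qed
  ultimately show ?thesis by simp
qed

lemma X_deriv_t: "((\<lambda>t. X t y) has_real_derivative F (exp (lam * t) * w0 y)) (at t)"
proof -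
  have "((\<lambda>t. (t, y)) has_derivative (\<lambda>h. (h, 0))) (at t)"
    by (auto intro!: derivative_eq_intros)
  from has_derivative_compose[OF this X_derivative] show ?thesis
    by (simp add: has_field_derivative_def mult_commute_abs)
qed

lemma X_deriv_y: "(X t has_real_derivative X_y t y) (at y)"
proof -
  have "((\<lambda>y. (t, y)) has_derivative (\<lambda>h. (0, h))) (at y)"
    by (auto intro!: derivative_eq_intros)
  from has_derivative_compose[OF this X_derivative] show ?thesis
    by (simp add: has_field_derivative_def mult_commute_abs)
qed

text \<open>
  This bound excludes shocks. A nonnegative signed slope of the data only spreads characteristics; a negative one is
  multiplied by at most \<open>M / |lam|\<close>, whatever the time, because the wave is damped.
\<close>

lemma X_y_ge:
  assumes "t \<ge> 0"
  shows "1 - \<theta> \<le> X_y t y"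
proof -
  define h where "h = sg * drift_w t (w0 y)"
  have h: "0 \<le> h" "h \<le> M / (- lam)" using drift_w_bounds[OF assms] by (auto simp: h_def)
  have "sg * sg = 1" using sg by (metis abs_mult_self_eq mult_1)
  then have eq: "X_y t y = 1 + h * (sg * w0' y)"
    by (simp add: X_y_def h_def mult.assoc mult.left_commute)
  show ?thesis
  proof (cases "0 \<le> sg * w0' y")
    case True
    then have "0 \<le> h * (sg * w0' y)" using h(1) by (rule mult_nonneg_nonneg[rotated])
    then show ?thesis using \<theta> by (simp add: eq)
  next
    case False
    have "M / (- lam) * (sg * w0' y) \<le> h * (sg * w0' y)"
      using False h(2) by (intro mult_right_mono_neg) auto
    moreover have "- \<theta> \<le> M * (sg * w0' y) / (- lam)"
      using w0'_lower[of y] lam by (simp add: field_simps)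
    ultimately show ?thesis by (simp add: eq)
  qed
qed

lemma X_bij: "t \<ge> 0 \<Longrightarrow> bij (X t)"
  using bij_of_derivative_ge[OF X_deriv_y _ X_y_ge] \<theta> by simp

definition Y :: "real \<Rightarrow> real \<Rightarrow> real" where
  "Y t = inv (X t)"

lemma X_Y: "t \<ge> 0 \<Longrightarrow> X t (Y t x) = x"
  and Y_X: "t \<ge> 0 \<Longrightarrow> Y t (X t y) = y"
  using X_bij[of t] by (simp_all add: Y_def bij_is_surj surj_f_inv_f bij_is_inj inv_f_f)

abbreviation halfplane :: "(real \<times> real) set" where
  "halfplane \<equiv> {0..} \<times> UNIV"

lemma F_bounded_along: "\<exists>K\<ge>0. \<forall>t\<ge>0. \<forall>y. \<bar>F (exp (lam * t) * w0 y)\<bar> \<le> K"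
proof -
  obtain B where B: "\<And>y. \<bar>w0 y\<bar> \<le> B"
    using w0_bounded by (auto simp: bounded_iff)
  have "continuous_on {-B..B} F"
    using F_deriv DERIV_isCont continuous_at_imp_continuous_on by blast
  then have "bounded (F ` {-B..B})"
    using compact_continuous_image compact_imp_bounded compact_Icc by blast
  then obtain K where K: "\<And>w. w \<in> {-B..B} \<Longrightarrow> \<bar>F w\<bar> \<le> K"
    unfolding bounded_iff real_norm_def by blast
  have le_B: "\<bar>exp (lam * t) * w0 y\<bar> \<le> 1 * B" if "t \<ge> 0" for t y
    unfolding abs_mult by (rule mult_mono) (use B[of y] exp_decay[OF that] in auto)
  have "\<bar>F (exp (lam * t) * w0 y)\<bar> \<le> K" if "t \<ge> 0" for t y
  proof (rule K)
    show "exp (lam * t) * w0 y \<in> {-B..B}"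
      using le_B[OF that, of y] unfolding atLeastAtMost_iff by linarith
  qed
  moreover from this[of 0 0] have "K \<ge> 0" by force
  ultimately show ?thesis by blast
qed

text \<open>
  The lower bound on \<open>X_y\<close> controls the dependence on \<open>x\<close>, and the bounded speed of the characteristics
  the dependence on \<open>t\<close>.
\<close>

lemma Y_lipschitz: "\<exists>L. L-lipschitz_on halfplane (\<lambda>z. Y (fst z) (snd z))"
proof -
  obtain K where K: "K \<ge> 0" "\<And>t y. t \<ge> 0 \<Longrightarrow> \<bar>F (exp (lam * t) * w0 y)\<bar> \<le> K"
    using F_bounded_along by blast
  have X_t: "\<bar>X t y - X t' y\<bar> \<le> K * \<bar>t - t'\<bar>" if "t \<ge> 0" "t' \<ge> 0" for t t' y
    using field_differentiable_bound[of "{0..}" "\<lambda>t. X t y" "\<lambda>t. F (exp (lam * t) * w0 y)" K t t']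
      has_field_derivative_at_within[OF X_deriv_t] K that by auto
  have X_y: "(1 - \<theta>) * \<bar>y - y'\<bar> \<le> \<bar>X t y - X t y'\<bar>" if "t \<ge> 0" for t y y'
    using growth_of_derivative_ge[OF X_deriv_y X_y_ge[OF that], of y y']
      growth_of_derivative_ge[OF X_deriv_y X_y_ge[OF that], of y' y]
    by (cases "y \<le> y'") (auto simp: abs_if split: if_splits)
  let ?L = "(1 + K) / (1 - \<theta>)"
  have "?L-lipschitz_on halfplane (\<lambda>z. Y (fst z) (snd z))"
  proof (rule lipschitz_onI)
    fix z z' :: "real \<times> real" assume z: "z \<in> halfplane" "z' \<in> halfplane"
    obtain t x t' x' where [simp]: "z = (t, x)" "z' = (t', x')" by (cases z, cases z')
    have t: "t \<ge> 0" "t' \<ge> 0" using z by auto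
    have "(1 - \<theta>) * \<bar>Y t x - Y t' x'\<bar> \<le> \<bar>X t (Y t x) - X t (Y t' x')\<bar>"
      by (rule X_y[OF t(1)])
    also have "\<dots> \<le> \<bar>X t (Y t x) - X t' (Y t' x')\<bar> + \<bar>X t (Y t' x') - X t' (Y t' x')\<bar>"
      by linarith
    also have "\<dots> \<le> \<bar>x - x'\<bar> + K * \<bar>t - t'\<bar>"
      using X_t[OF t, of "Y t' x'"] by (simp add: X_Y t)
    also have "\<dots> \<le> dist z z' + K * dist z z'"
      using dist_fst_le[of z z'] dist_snd_le[of z z'] K(1)
      by (intro add_mono mult_left_mono) (auto simp: dist_real_def)
    finally show "dist (Y (fst z) (snd z)) (Y (fst z') (snd z')) \<le> ?L * dist z z'"
      using \<theta> by (simp add: dist_real_def field_simps)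
  next
    show "0 \<le> ?L" using K \<theta> by simp
  qed
  then show ?thesis by blast
qed

text \<open>
  The map \<open>(t, y) \<mapsto> (t, X t y)\<close> sends the closed half-plane onto itself, so the derivative of
  its inverse can be taken within the half-plane, one-sided in time at \<open>t = 0\<close>.
\<close>

lemma Y_derivative:
  assumes "t \<ge> 0"
  shows "((\<lambda>z. Y (fst z) (snd z)) has_derivative
     (\<lambda>d. (snd d - F (exp (lam * t) * w0 (Y t x)) * fst d) / X_y t (Y t x))) (at (t, x) within halfplane)"
proof -
  define y where "y = Y t x"
  define c where "c = F (exp (lam * t) * w0 y)"
  let ?\<Psi> = "\<lambda>z. (fst z, X (fst z) (snd z))"
  let ?\<Phi> = "\<lambda>z. (fst z, Y (fst z) (snd z))"
  have D: "X_y t y \<noteq> 0" using X_y_ge[OF assms, of y] \<theta> by auto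
  have img: "?\<Psi> ` halfplane = halfplane"
  proof
    show "halfplane \<subseteq> ?\<Psi> ` halfplane"
    proof
      fix z :: "real \<times> real" assume "z \<in> halfplane"
      then have "z = ?\<Psi> (?\<Phi> z)" "?\<Phi> z \<in> halfplane" by (auto simp: X_Y)
      then show "z \<in> ?\<Psi> ` halfplane" by blast
    qed
  qed auto
  have at: "?\<Psi> (t, y) = (t, x)" using assms by (simp add: y_def X_Y)
  have \<Psi>: "(?\<Psi> has_derivative (\<lambda>d. (fst d, c * fst d + X_y t y * snd d))) (at (t, y) within halfplane)"
    unfolding c_def
    by (intro has_derivative_Pair has_derivative_fst has_derivative_ident
        has_derivative_at_withinI[OF X_derivative])
  obtain L where "L-lipschitz_on halfplane (\<lambda>z. Y (fst z) (snd z))" using Y_lipschitz by blast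
  then have "continuous_on halfplane (\<lambda>z. Y (fst z) (snd z))"
    by (rule lipschitz_on_continuous_on)
  then have cont: "continuous_on halfplane ?\<Phi>" by (intro continuous_intros)
  have "(?\<Phi> has_derivative (\<lambda>d. (fst d, (snd d - c * fst d) / X_y t y)))
      (at (?\<Psi> (t, y)) within ?\<Psi> ` halfplane)"
  proof (rule has_derivative_inverse_within[OF \<Psi>])
    show "continuous (at (?\<Psi> (t, y)) within ?\<Psi> ` halfplane) ?\<Phi>"
      unfolding img at using cont assms by (simp add: continuous_on_eq_continuous_within)
    show "linear (\<lambda>d. (fst d, (snd d - c * fst d) / X_y t y))"
      by (rule linearI) (auto simp: algebra_simps diff_divide_distrib add_divide_distrib)
    show "(\<lambda>d. (fst d, (snd d - c * fst d) / X_y t y)) \<circ> (\<lambda>d. (fst d, c * fst d + X_y t y * snd d)) = id"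
      using D by auto
  qed (use assms Y_X in auto)
  then have "(?\<Phi> has_derivative (\<lambda>d. (fst d, (snd d - c * fst d) / X_y t y))) (at (t, x) within halfplane)"
    unfolding img at .
  from has_derivative_snd[OF this] show ?thesis
    by (simp add: y_def c_def)
qed

text \<open>
  The value at \<open>(t, x)\<close> is the value of the data at the foot of the characteristic through \<open>(t, x)\<close>, damped by
  \<open>exp (lam t)\<close>. The time derivative \<open>sol_t\<close> is defined by the equation itself; \<open>sol_derivative\<close> justifies it.
\<close>

definition sol :: "real \<Rightarrow> real \<Rightarrow> real" where
  "sol t x = exp (lam * t) * w0 (Y t x)"

definition sol_x :: "real \<Rightarrow> real \<Rightarrow> real" where
  "sol_x t x = exp (lam * t) * w0' (Y t x) / X_y t (Y t x)"

definition sol_t :: "real \<Rightarrow> real \<Rightarrow> real" where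
  "sol_t t x = lam * sol t x - F (sol t x) * sol_x t x"

lemma sol_derivative:
  assumes "t \<ge> 0"
  shows "((\<lambda>z. sol (fst z) (snd z)) has_derivative
     (\<lambda>d. sol_t t x * fst d + sol_x t x * snd d)) (at (t, x) within halfplane)"
proof -
  have D: "X_y t (Y t x) \<noteq> 0" using X_y_ge[OF assms, of "Y t x"] \<theta> by auto
  have w: "((\<lambda>z. w0 (Y (fst z) (snd z))) has_derivative
     (\<lambda>d. ((snd d - F (exp (lam * t) * w0 (Y t x)) * fst d) / X_y t (Y t x)) * w0' (Y t x)))
     (at (t, x) within halfplane)"
    by (rule DERIV_compose_FDERIV[OF _ Y_derivative[OF assms]]) (simp add: w0_deriv)
  have q: "((\<lambda>z. exp (lam * fst z)) has_derivative (\<lambda>d. lam * fst d * exp (lam * t)))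
     (at (t, x) within halfplane)"
    by (auto intro!: derivative_eq_intros)
  from has_derivative_mult[OF q w] show ?thesis
    unfolding sol_def sol_x_def sol_t_def
    by (rule has_derivative_eq_rhs) (use D in \<open>auto simp: field_simps\<close>)
qed

lemma sol_initial: "sol 0 x = w0 x"
proof -
  have "X 0 x = x" by (simp add: X_def drift_def)
  then have "Y 0 x = x" using Y_X[of 0 x] by simp
  then show ?thesis by (simp add: sol_def)
qed

lemma w0_buc: "buc UNIV w0"
  unfolding buc_def
  using w0_bounded uniformly_continuous_on_bounded_derivative[of UNIV w0 w0'] w0_deriv w0'_buc
  by (auto simp: buc_def)

lemma decay_buc: "buc halfplane (\<lambda>z. exp (lam * fst z))"
proof -
  have "buc {0..} (\<lambda>t. exp (lam * t))"
    unfolding buc_def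
  proof
    show "bounded ((\<lambda>t. exp (lam * t)) ` {0..})"
      using exp_decay by (auto simp: bounded_iff intro!: exI[of _ 1])
    show "uniformly_continuous_on {0..} (\<lambda>t. exp (lam * t))"
    proof (rule uniformly_continuous_on_bounded_derivative)
      show "((\<lambda>t. exp (lam * t)) has_real_derivative lam * exp (lam * t)) (at t within {0..})" for t
        by (auto intro!: derivative_eq_intros)
      have "\<bar>lam\<bar> * exp (lam * t) \<le> \<bar>lam\<bar> * 1" if "t \<ge> 0" for t
        using exp_decay[OF that] by (intro mult_left_mono) auto
      then show "bounded ((\<lambda>t. lam * exp (lam * t)) ` {0..})"
        by (auto simp: bounded_iff abs_mult intro!: exI[of _ "\<bar>lam\<bar>"])
    qed auto
  qed
  then show ?thesis
    by (rule buc_reparametrize) (auto intro: bounded_linear.uniformly_continuous_on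
        [OF bounded_linear_fst uniformly_continuous_on_id])
qed

text \<open>
  Time enters only through \<open>exp (lam t)\<close> and the Lipschitz map \<open>Y\<close>, and the defining formulas are continuous in \<open>exp (lam t)\<close>, \<open>w0 \<circ> Y\<close>
  and \<open>w0' \<circ> Y\<close>; this gives uniformity up to infinite time.
\<close>

lemma sol_buc:
  shows "buc halfplane (\<lambda>z. sol (fst z) (snd z))"
    and "buc halfplane (\<lambda>z. sol_x (fst z) (snd z))"
    and "buc halfplane (\<lambda>z. sol_t (fst z) (snd z))"
proof -
  obtain L where "L-lipschitz_on halfplane (\<lambda>z. Y (fst z) (snd z))" using Y_lipschitz by blast
  then have Y: "uniformly_continuous_on halfplane (\<lambda>z. Y (fst z) (snd z))"
    by (rule lipschitz_on_uniformly_continuous)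
  have a: "buc halfplane (\<lambda>z. w0 (Y (fst z) (snd z)))"
    and a': "buc halfplane (\<lambda>z. w0' (Y (fst z) (snd z)))"
    using buc_reparametrize[OF w0_buc Y] buc_reparametrize[OF w0'_buc Y] by auto
  show s: "buc halfplane (\<lambda>z. sol (fst z) (snd z))"
    unfolding sol_def by (rule buc_mult[OF decay_buc a])
  have "buc halfplane (\<lambda>z. drift_w (fst z) (w0 (Y (fst z) (snd z))))"
    unfolding drift_w_def divide_inverse
    by (intro buc_mult buc_diff buc_const decay_buc a buc_compose[OF _ slope_continuous])
  then have D: "buc halfplane (\<lambda>z. X_y (fst z) (Y (fst z) (snd z)))"
    unfolding X_y_def by (intro buc_add buc_mult buc_const a')
  show x: "buc halfplane (\<lambda>z. sol_x (fst z) (snd z))"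
    unfolding sol_x_def
    by (rule buc_divide[OF buc_mult[OF decay_buc a'] D, of "1 - \<theta>"]) (use X_y_ge \<theta> in auto)
  have "continuous_on UNIV F"
    using F_deriv DERIV_isCont continuous_at_imp_continuous_on by blast
  then show "buc halfplane (\<lambda>z. sol_t (fst z) (snd z))"
    unfolding sol_t_def by (intro buc_diff buc_mult buc_const s x buc_compose[OF s])
qed

end

section \<open>Linearizing the source term\<close>

text \<open>
  The hypotheses determine the signs of \<open>f''\<close> and of \<open>g\<close> only near \<open>ubar\<close>. Freezing functions outside an interval makes local
  objects global, so that bijections and antiderivatives on the whole line can be used.
\<close>

definition clip :: "real \<Rightarrow> real \<Rightarrow> real" where
  "clip d s = max (- d) (min d s)"

lemma clip_bounds: "0 \<le> d \<Longrightarrow> \<bar>clip d s\<bar> \<le> d"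
  and clip_eq: "\<bar>s\<bar> \<le> d \<Longrightarrow> clip d s = s"
  by (auto simp: clip_def)

lemma continuous_on_compose_clip:
  assumes "continuous_on {-d..d} h" and "0 \<le> d"
  shows "continuous_on UNIV (\<lambda>s. h (clip d s))"
proof (rule continuous_on_compose2[OF assms(1)])
  show "continuous_on UNIV (clip d)"
    unfolding clip_def by (intro continuous_intros)
  show "range (clip d) \<subseteq> {-d..d}"
    using assms(2) by (auto simp: clip_def)
qed

lemma continuous_at_zero_interval:
  fixes h :: "real \<Rightarrow> real"
  assumes "isCont h 0" and "open A" "h 0 \<in> A"
  obtains d where "d > 0" "\<And>s. \<bar>s\<bar> \<le> d \<Longrightarrow> h s \<in> A"
proof -
  have "\<forall>\<^sub>F s in nhds 0. h s \<in> A"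
    using assms topological_tendstoD unfolding isCont_def tendsto_at_iff_tendsto_nhds by blast
  then obtain e where "e > 0" "\<And>s. dist s 0 < e \<Longrightarrow> h s \<in> A"
    by (auto simp: eventually_nhds_metric)
  then show ?thesis by (intro that[of "e/2"]) auto
qed

lemma second_order_quotient_limit:
  fixes G :: "real \<Rightarrow> real"
  assumes G': "\<And>s. (G has_real_derivative G' s) (at s)" and G'': "(G' has_real_derivative c) (at 0)"
    and "G 0 = 0"
  shows "((\<lambda>s. (G s - G' 0 * s) / s\<^sup>2) \<longlongrightarrow> c / 2) (at 0)"
proof (rule lhopital)
  have "((\<lambda>s. G s - G' 0 * s) \<longlongrightarrow> G 0 - G' 0 * 0) (at 0)"
    using DERIV_isCont[OF G'[of 0]] by (intro tendsto_intros) (simp add: isCont_def)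
  then show "((\<lambda>s. G s - G' 0 * s) \<longlongrightarrow> 0) (at 0)" using \<open>G 0 = 0\<close> by simp
  have "((\<lambda>s. s\<^sup>2) \<longlongrightarrow> (0::real)\<^sup>2) (at 0)" by (intro tendsto_intros)
  then show "((\<lambda>s::real. s\<^sup>2) \<longlongrightarrow> 0) (at 0)" by simp
  show "\<forall>\<^sub>F s::real in at 0. s\<^sup>2 \<noteq> 0" "\<forall>\<^sub>F s::real in at 0. 2 * s \<noteq> 0"
    by (auto simp: eventually_at_filter)
  show "\<forall>\<^sub>F s in at 0. ((\<lambda>s. G s - G' 0 * s) has_real_derivative (G' s - G' 0)) (at s)"
    by (intro always_eventually allI) (auto intro!: derivative_eq_intros G')
  show "\<forall>\<^sub>F s::real in at 0. ((\<lambda>s. s\<^sup>2) has_real_derivative (2 * s)) (at s)"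
    by (intro always_eventually allI) (auto intro!: derivative_eq_intros)
  have "((\<lambda>s. (G' s - G' 0) / (s - 0)) \<longlongrightarrow> c) (at 0)"
    using G'' by (simp add: has_field_derivative_iff)
  then have "((\<lambda>s. (G' s - G' 0) / (s - 0) / 2) \<longlongrightarrow> c / 2) (at 0)"
    by (intro tendsto_intros) auto
  then show "((\<lambda>s. (G' s - G' 0) / (2 * s)) \<longlongrightarrow> c / 2) (at 0)"
    by (simp add: mult.commute)
qed

text \<open>
  A \<open>C\<^sup>1\<close> linearization of the equation \<open>s' = G s\<close> at a hyperbolic zero. Near \<open>0\<close> it is \<open>\<psi> s = s exp (K s)\<close> with
  \<open>K' = - r / q\<close>, where \<open>G s = s q(s)\<close> and \<open>q s = G' 0 + s r(s)\<close>. Indeed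
  \<open>\<psi>' = exp K (1 - s r / q) = exp K (G' 0) / q\<close>, so \<open>G \<psi>' = G' 0 \<psi>\<close>. The second derivative of \<open>G\<close> at \<open>0\<close> is what makes
  \<open>r\<close> continuous. Away from \<open>0\<close> the derivative \<open>m\<close> of \<open>\<psi>\<close> is frozen, which keeps it within \<open>1 / \<kappa>\<close> and \<open>\<kappa>\<close>
  on the whole line.
\<close>

lemma linearizing_coordinate:
  fixes G :: "real \<Rightarrow> real"
  assumes G': "\<And>s. (G has_real_derivative G' s) (at s)" and G'': "(G' has_real_derivative c) (at 0)"
    and G0: "G 0 = 0" and neg: "G' 0 < 0" and \<kappa>: "\<kappa> > 1"
  obtains d m \<psi> where "d > 0" "continuous_on UNIV m" "\<And>s. 1 / \<kappa> \<le> m s" "\<And>s. m s \<le> \<kappa>"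
    "\<psi> 0 = 0" "\<And>s. (\<psi> has_real_derivative m s) (at s)"
    "\<And>s. \<bar>s\<bar> \<le> d \<Longrightarrow> G s * m s = G' 0 * \<psi> s"
proof -
  let ?lam = "G' 0"
  define r where "r s = (if s = 0 then c / 2 else (G s - ?lam * s) / s\<^sup>2)" for s
  define q where "q s = ?lam + s * r s" for s
  have "isCont r s" for s
  proof (cases "s = 0")
    case True
    have "(r \<longlongrightarrow> c / 2) (at 0)"
      by (rule Lim_transform_eventually[OF second_order_quotient_limit[OF G' G'' G0]])
        (simp add: eventually_at_filter r_def)
    then show ?thesis using True by (simp add: isCont_def r_def)
  next
    case False
    have "isCont (\<lambda>s. (G s - ?lam * s) / s\<^sup>2) s"
      using False DERIV_isCont[OF G'[of s]] by (auto intro!: continuous_intros)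
    moreover have "\<forall>\<^sub>F y in nhds s. (G y - ?lam * y) / y\<^sup>2 = r y"
      using t1_space_nhds[OF False] by (rule eventually_mono) (simp add: r_def)
    ultimately show ?thesis using isCont_cong by fast
  qed
  then have r: "continuous_on A r" for A
    by (simp add: continuous_at_imp_continuous_on)
  then have q: "continuous_on A q" for A
    unfolding q_def by (intro continuous_intros)
  have Gq: "G s = s * q s" for s
    by (simp add: q_def r_def G0 power2_eq_square field_simps)
  have q0: "q 0 = ?lam" by (simp add: q_def)
  obtain d0 where d0: "d0 > 0" "\<And>s. \<bar>s\<bar> \<le> d0 \<Longrightarrow> q s \<in> {..<0}"
    by (rule continuous_at_zero_interval[of q "{..<0}"])
      (use q[of UNIV] neg q0 in \<open>auto simp: continuous_on_eq_continuous_at\<close>)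
  have qneg: "q (clip d0 s) < 0" for s
    using d0 clip_bounds[of d0 s] by simp
  have qc: "continuous_on UNIV (\<lambda>s. q (clip d0 s))" and rc: "continuous_on UNIV (\<lambda>s. r (clip d0 s))"
    using continuous_on_compose_clip[OF q] continuous_on_compose_clip[OF r] d0(1) by simp_all
  have "continuous_on UNIV (\<lambda>s. - r (clip d0 s) / q (clip d0 s))"
    using qneg by (intro continuous_intros qc rc) (metis less_irrefl)
  then obtain K where K: "K 0 = 0"
    "\<And>s. (K has_real_derivative - r (clip d0 s) / q (clip d0 s)) (at s)"
    using antiderivative_exists[where c = 0 and a = 0] by blast
  define n where "n s = exp (K s) * ?lam / q (clip d0 s)" for s
  have "continuous_on UNIV K"
    using K(2) DERIV_isCont continuous_at_imp_continuous_on by blast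
  then have n: "continuous_on UNIV n"
    unfolding n_def using qneg by (intro continuous_intros qc) (auto simp: less_le)
  have n0: "n 0 = 1"
    using d0(1) neg by (simp add: n_def K(1) clip_eq q0)
  obtain d1 where d1: "d1 > 0" "\<And>s. \<bar>s\<bar> \<le> d1 \<Longrightarrow> n s \<in> {1/\<kappa><..<\<kappa>}"
    by (rule continuous_at_zero_interval[of n "{1/\<kappa><..<\<kappa>}"])
      (use n n0 \<kappa> in \<open>auto simp: continuous_on_eq_continuous_at\<close>)
  define d where "d = min d0 d1"
  have d: "d > 0" "d \<le> d0" "d \<le> d1" using d0 d1 by (auto simp: d_def)
  define m where "m s = n (clip d s)" for s
  have m: "continuous_on UNIV m"
    unfolding m_def using continuous_on_subset[OF n] d(1) by (intro continuous_on_compose_clip) auto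
  have m_bounds: "1/\<kappa> < m s" "m s < \<kappa>" for s
    using d1(2)[of "clip d s"] clip_bounds[of d s] d by (auto simp: m_def)
  obtain \<psi> where \<psi>: "\<psi> 0 = 0" "\<And>s. (\<psi> has_real_derivative m s) (at s)"
    using antiderivative_exists[OF m, of 0 0] by blast
  have \<psi>_eq: "\<psi> s = s * exp (K s)" if "\<bar>s\<bar> \<le> d" for s
  proof -
    have "((\<lambda>s. \<psi> s - s * exp (K s)) has_real_derivative 0) (at s within {-d..d})"
      if "s \<in> {-d..d}" for s
    proof -
      have s: "clip d s = s" "clip d0 s = s" using that d by (auto simp: clip_def)
      have "q s \<noteq> 0" using qneg[of s] s by simp
      then have eq: "m s - (exp (K s) + s * (exp (K s) * (- r s / q s))) = 0"
        by (simp add: m_def n_def s field_simps) (simp add: q_def algebra_simps)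
      have "((\<lambda>s. \<psi> s - s * exp (K s)) has_real_derivative
          m s - (exp (K s) + s * (exp (K s) * (- r s / q s)))) (at s)"
        using K(2)[of s] by (auto intro!: derivative_eq_intros \<psi>(2) simp: s)
      then show ?thesis unfolding eq by (rule has_field_derivative_at_within)
    qed
    then obtain b where b: "\<And>s. s \<in> {-d..d} \<Longrightarrow> \<psi> s - s * exp (K s) = b"
      using has_field_derivative_zero_constant[of "{-d..d}" "\<lambda>s. \<psi> s - s * exp (K s)"] by auto
    show ?thesis using b[of s] b[of 0] that d(1) \<psi>(1) by (auto simp: abs_le_iff)
  qed
  have "G s * m s = ?lam * \<psi> s" if "\<bar>s\<bar> \<le> d" for s
  proof -
    have s: "clip d s = s" "clip d0 s = s" using that d by (auto simp: clip_def)
    have "q s \<noteq> 0" using qneg[of s] s by simp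
    then show ?thesis by (simp add: \<psi>_eq[OF that] Gq m_def n_def s)
  qed
  then show ?thesis
    using that[of d m \<psi>] d(1) m m_bounds \<psi> by (simp add: less_imp_le)
qed

section \<open>Uniqueness along characteristics\<close>

text \<open>
  Gronwall: \<open>exp (- 2 L t) (h t)\<^sup>2\<close> is nonincreasing, nonnegative and starts from \<open>0\<close>.
\<close>

lemma zero_of_linear_growth:
  fixes h h' :: "real \<Rightarrow> real"
  assumes der: "\<And>t. t \<ge> 0 \<Longrightarrow> (h has_real_derivative h' t) (at t within {0..})"
    and growth: "\<And>t. t \<ge> 0 \<Longrightarrow> \<bar>h' t\<bar> \<le> L * \<bar>h t\<bar>"
    and "h 0 = 0" "t \<ge> 0"
  shows "h t = 0"
proof -
  let ?e = "\<lambda>t. exp (- (2 * L * t)) * (h t)\<^sup>2"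
  let ?e' = "\<lambda>t. exp (- (2 * L * t)) * (2 * (h t * h' t) - 2 * L * (h t)\<^sup>2)"
  have e': "(?e has_real_derivative ?e' s) (at s within {0..})" if "s \<ge> 0" for s
    by (auto intro!: derivative_eq_intros der[OF that] simp: algebra_simps power2_eq_square)
  have "?e t \<le> ?e 0"
  proof (rule DERIV_nonpos_imp_decreasing_open[OF \<open>t \<ge> 0\<close>])
    fix s assume s: "0 < s" "s < t"
    have "h s * h' s \<le> \<bar>h s\<bar> * \<bar>h' s\<bar>" by (metis abs_ge_self abs_mult)
    also have "\<dots> \<le> \<bar>h s\<bar> * (L * \<bar>h s\<bar>)" using growth[of s] s by (intro mult_left_mono) auto
    also have "\<dots> = L * (h s)\<^sup>2" by (simp add: power2_eq_square)
    finally have "?e' s \<le> 0" by (intro mult_nonneg_nonpos) auto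
    moreover have "at s within {0..} = at s"
      by (rule at_within_interior) (use s in auto)
    then have "(?e has_real_derivative ?e' s) (at s)" using e'[of s] s by simp
    ultimately show "\<exists>y. (?e has_real_derivative y) (at s) \<and> y \<le> 0" by blast
  next
    have "continuous_on {0..} ?e"
      using DERIV_continuous[OF e'] by (simp add: continuous_on_eq_continuous_within)
    then show "continuous_on {0..t} ?e" by (rule continuous_on_subset) auto
  qed
  then show ?thesis using \<open>h 0 = 0\<close> by (simp add: mult_le_0_iff)
qed

lemma lipschitz_on_symmetric_interval:
  fixes h h' :: "real \<Rightarrow> real"
  assumes "\<And>x. (h has_real_derivative h' x) (at x)" "continuous_on UNIV h'"
  shows "\<exists>L\<ge>0. \<forall>a b. \<bar>a\<bar> \<le> R \<longrightarrow> \<bar>b\<bar> \<le> R \<longrightarrow> \<bar>h a - h b\<bar> \<le> L * \<bar>a - b\<bar>"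
proof -
  have "bounded (h' ` {-R..R})"
    using assms(2) continuous_on_subset compact_continuous_image compact_imp_bounded compact_Icc
    by (metis subset_UNIV)
  then obtain L where L: "\<And>x. x \<in> {-R..R} \<Longrightarrow> \<bar>h' x\<bar> \<le> L"
    unfolding bounded_iff real_norm_def by blast
  have "\<bar>h a - h b\<bar> \<le> \<bar>L\<bar> * \<bar>a - b\<bar>" if "\<bar>a\<bar> \<le> R" "\<bar>b\<bar> \<le> R" for a b
    using field_differentiable_bound[of "{-R..R}" h h' "\<bar>L\<bar>" a b] that L
      has_field_derivative_at_within[OF assms(1)] by (force simp: abs_le_iff)
  then show ?thesis by (intro exI[of _ "\<bar>L\<bar>"]) auto
qed

text \<open>
  A curve \<open>Z\<close> together with the values \<open>U\<close> that a solution must take along it. The pair is described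
  without reference to a solution, so it can be compared with every solution.
\<close>

definition bounded_characteristic ::
  "(real \<Rightarrow> real) \<Rightarrow> (real \<Rightarrow> real) \<Rightarrow> (real \<Rightarrow> real) \<Rightarrow> (real \<Rightarrow> real) \<Rightarrow> bool" where
  "bounded_characteristic f g Z U \<longleftrightarrow>
     (\<forall>s\<ge>0. (Z has_real_derivative deriv f (U s)) (at s within {0..}) \<and>
            (U has_real_derivative g (U s)) (at s within {0..})) \<and>
     bounded (U ` {0..})"

text \<open>
  Let \<open>h = w(s, Z s) - U s\<close>. By the equation for \<open>w\<close>, \<open>h'\<close> is the difference of \<open>g\<close> at the two states minus the
  difference of \<open>f'\<close> at the two states times \<open>\<partial>\<^sub>x w\<close>. All states stay bounded, where \<open>g\<close> and \<open>f'\<close> are Lipschitz,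
  and \<open>\<partial>\<^sub>x w\<close> is bounded; so \<open>|h'| \<le> L |h|\<close> and \<open>h\<close> vanishes.
\<close>

lemma classical_solution_on_characteristic:
  assumes "C2 f" "C2 g" and sol: "global_classical_solution f g u0 w"
    and ZU: "bounded_characteristic f g Z U" and init: "U 0 = u0 (Z 0)" and t: "t \<ge> 0"
  shows "w t (Z t) = U t"
proof -
  have Z: "\<And>s. s \<ge> 0 \<Longrightarrow> (Z has_real_derivative deriv f (U s)) (at s within {0..})"
    and U: "\<And>s. s \<ge> 0 \<Longrightarrow> (U has_real_derivative g (U s)) (at s within {0..})"
    and U_bounded: "bounded (U ` {0..})"
    using ZU by (auto simp: bounded_characteristic_def)
  let ?S = "{0..} \<times> UNIV :: (real \<times> real) set"
  have "BUC1 ?S (\<lambda>(t, x). w t x)" and init_w: "\<And>x. w 0 x = u0 x"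
    and pde: "\<And>t x. t \<ge> 0 \<Longrightarrow> \<exists>ut fx. ((\<lambda>s. w s x) has_real_derivative ut) (at t within {0..}) \<and>
        ((\<lambda>y. f (w t y)) has_real_derivative fx) (at x) \<and> ut + fx = g (w t x)"
    using sol by (auto simp: global_classical_solution_def)
  then obtain D :: "real \<times> real \<Rightarrow> (real \<times> real) \<Rightarrow>\<^sub>L real"
    where w_bounded: "bounded ((\<lambda>(t, x). w t x) ` ?S)" and D_bounded: "bounded (D ` ?S)"
      and D: "\<And>z. z \<in> ?S \<Longrightarrow> ((\<lambda>(t, x). w t x) has_derivative D z) (at z within ?S)"
    unfolding BUC1_def by blast
  define wt where "wt t x = D (t, x) (1, 0)" for t x
  define wx where "wx t x = D (t, x) (0, 1)" for t x
  have along: "((\<lambda>s. w s (\<zeta> s)) has_real_derivative wt s (\<zeta> s) + wx s (\<zeta> s) * b) (at s within {0..})"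
    if "s \<ge> 0" "(\<zeta> has_real_derivative b) (at s within {0..})" for s b \<zeta>
  proof -
    have "((\<lambda>s. (s, \<zeta> s)) has_derivative (\<lambda>h. (h, b * h))) (at s within {0..})"
      using that(2) by (auto intro!: derivative_eq_intros simp: has_field_derivative_def)
    from has_derivative_in_compose2[OF D _ _ this] that(1)
    have "((\<lambda>s. w s (\<zeta> s)) has_derivative (\<lambda>h. D (s, \<zeta> s) (h, b * h))) (at s within {0..})"
      by auto
    moreover have "D (s, \<zeta> s) (h, b * h) = (wt s (\<zeta> s) + wx s (\<zeta> s) * b) * h" for h
    proof -
      have "(h, b * h) = h *\<^sub>R (1, 0) + (b * h) *\<^sub>R (0, 1)" by simp
      then have "D (s, \<zeta> s) (h, b * h) = h * wt s (\<zeta> s) + (b * h) * wx s (\<zeta> s)"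
        by (simp only: blinfun.add_right blinfun.scaleR_right wt_def wx_def real_scaleR_def)
      then show ?thesis by (simp add: algebra_simps)
    qed
    ultimately show ?thesis by (simp add: has_field_derivative_def)
  qed
  have wx: "(w t has_real_derivative wx t x) (at x)" if "t \<ge> 0" for t x
  proof -
    have "((\<lambda>y. (t, y)) has_derivative (\<lambda>h. (0, h))) (at x)"
      by (auto intro!: derivative_eq_intros)
    from has_derivative_in_compose2[OF D _ _ this] that
    have "(w t has_derivative (\<lambda>h. D (t, x) (0, h))) (at x)"
      by auto
    moreover have "D (t, x) (0, h) = wx t x * h" for h
      using blinfun.scaleR_right[of "D (t, x)" h "(0, 1)"] by (simp add: wx_def)
    ultimately show ?thesis by (simp add: has_field_derivative_def)
  qed
  \<comment> \<open>The derivatives provided by the definition of a solution are the partial derivatives of w, by uniqueness of one-sided derivatives.\<close>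
  have transport: "wt t x + deriv f (w t x) * wx t x = g (w t x)" if t: "t \<ge> 0" for t x
  proof -
    obtain ut fx where ut: "((\<lambda>s. w s x) has_real_derivative ut) (at t within {0..})"
      and fx: "((\<lambda>y. f (w t y)) has_real_derivative fx) (at x)" and eq: "ut + fx = g (w t x)"
      using pde[OF t] by blast
    have "((\<lambda>s. w s x) has_real_derivative wt t x) (at t within {0..})"
      using along[OF t, of "\<lambda>_. x" 0] by simp
    moreover have "at t within {0..} \<noteq> bot"
      unfolding trivial_limit_within
      using t islimpt_subset[OF islimpt_greaterThanLessThan1[of t "t + 1"], of "{0..}"] by force
    ultimately have "ut = wt t x"
      using ut vector_derivative_unique_within
      by (metis has_real_derivative_iff_has_vector_derivative)
    moreover have "fx = deriv f (w t x) * wx t x"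
      using DERIV_unique[OF fx DERIV_chain2[OF C2_derivatives(1)[OF \<open>C2 f\<close>] wx[OF t]]] .
    ultimately show ?thesis using eq by simp
  qed
  obtain R1 where R1: "\<And>s. s \<ge> 0 \<Longrightarrow> \<bar>U s\<bar> \<le> R1"
    using U_bounded by (auto simp: bounded_iff)
  obtain R2 where R2: "\<And>s x. s \<ge> 0 \<Longrightarrow> \<bar>w s x\<bar> \<le> R2"
    using w_bounded by (auto simp: bounded_iff)
  define R where "R = max R1 R2"
  obtain B where B: "\<And>z. z \<in> ?S \<Longrightarrow> norm (D z) \<le> B"
    using D_bounded unfolding bounded_iff by blast
  have wx_bound: "\<bar>wx s x\<bar> \<le> B" if "s \<ge> 0" for s x
    using norm_blinfun[of "D (s, x)" "(0, 1)"] B[of "(s, x)"] that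
    by (simp add: wx_def norm_Pair)
  obtain L1 where L1: "L1 \<ge> 0" "\<And>a b. \<bar>a\<bar> \<le> R \<Longrightarrow> \<bar>b\<bar> \<le> R \<Longrightarrow> \<bar>deriv f a - deriv f b\<bar> \<le> L1 * \<bar>a - b\<bar>"
    using lipschitz_on_symmetric_interval[OF C2_derivatives(2,3)[OF \<open>C2 f\<close>], of R] by blast
  have "continuous_on UNIV (deriv g)"
    using C2_derivatives(2)[OF \<open>C2 g\<close>] DERIV_isCont continuous_at_imp_continuous_on by blast
  then obtain L2 where L2: "\<And>a b. \<bar>a\<bar> \<le> R \<Longrightarrow> \<bar>b\<bar> \<le> R \<Longrightarrow> \<bar>g a - g b\<bar> \<le> L2 * \<bar>a - b\<bar>"
    using lipschitz_on_symmetric_interval[OF C2_derivatives(1)[OF \<open>C2 g\<close>], of R] by blast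
  let ?h = "\<lambda>s. w s (Z s) - U s"
  let ?h' = "\<lambda>s. wt s (Z s) + wx s (Z s) * deriv f (U s) - g (U s)"
  have "?h t = 0"
  proof (rule zero_of_linear_growth[of ?h ?h' "L2 + L1 * B"])
    fix s :: real assume s: "s \<ge> 0"
    show "(?h has_real_derivative ?h' s) (at s within {0..})"
      by (intro DERIV_diff along Z U s)
    have bds: "\<bar>w s (Z s)\<bar> \<le> R" "\<bar>U s\<bar> \<le> R"
      using R1[OF s] R2[OF s, of "Z s"] by (auto simp: R_def)
    have "?h' s = (g (w s (Z s)) - g (U s)) - (deriv f (w s (Z s)) - deriv f (U s)) * wx s (Z s)"
      using transport[OF s, of "Z s"] by (simp add: algebra_simps)
    also have "\<bar>\<dots>\<bar> \<le> \<bar>g (w s (Z s)) - g (U s)\<bar> + \<bar>deriv f (w s (Z s)) - deriv f (U s)\<bar> * \<bar>wx s (Z s)\<bar>"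
      by (metis abs_mult abs_triangle_ineq4)
    also have "\<dots> \<le> L2 * \<bar>?h s\<bar> + L1 * \<bar>?h s\<bar> * B"
      using L1 L2 bds wx_bound[OF s, of "Z s"] by (intro add_mono mult_mono) auto
    finally show "\<bar>?h' s\<bar> \<le> (L2 + L1 * B) * \<bar>?h s\<bar>" by (simp add: algebra_simps)
  qed (use init init_w t in auto)
  then show ?thesis by simp
qed

section \<open>Small data near the equilibrium\<close>

text \<open>
  The transport solution, pulled back by the linearizing coordinate. Every point of the half-plane
  lies on a characteristic, and the solution and its slope there are bounded by their values at the
  foot \<open>Z 0\<close>; that the factor \<open>c\<close> is nonnegative is what allows negative parts to be compared. The
  factor \<open>\<kappa>\<^sup>3\<close> combines two distortions by \<open>\<psi>'\<close> and one by the Jacobian of the characteristics.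
\<close>

lemma solution_near_equilibrium:
  fixes f g :: "real \<Rightarrow> real" and ubar \<kappa> :: real
  assumes f: "C2 f" and g: "C2 g" and eq: "g ubar = 0" and neg: "deriv g ubar < 0"
    and nonlin: "deriv (deriv f) ubar \<noteq> 0" and \<kappa>: "\<kappa> > 1"
  defines "lam \<equiv> deriv g ubar" and "sg \<equiv> sgn (deriv (deriv f) ubar)"
  shows "\<exists>\<epsilon>>0. \<forall>v0 v0'. (\<forall>y. (v0 has_real_derivative v0' y) (at y)) \<longrightarrow> buc UNIV v0' \<longrightarrow>
    (\<forall>y. \<bar>v0 y\<bar> \<le> \<epsilon>) \<longrightarrow> (\<forall>y. - \<epsilon> \<le> sg * v0' y) \<longrightarrow>
    (\<exists>u. global_classical_solution f g (\<lambda>x. ubar + v0 x) u \<and>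
      (\<forall>t\<ge>0. continuous_on UNIV (deriv (u t))) \<and>
      (\<forall>t\<ge>0. \<forall>x. \<exists>Z U c.
         bounded_characteristic f g Z U \<and> U 0 = ubar + v0 (Z 0) \<and> Z t = x \<and> U t = u t x \<and>
         \<bar>u t x - ubar\<bar> \<le> \<kappa> ^ 3 * exp (lam * t) * \<bar>v0 (Z 0)\<bar> \<and>
         0 \<le> c \<and> c \<le> \<kappa> ^ 3 * exp (lam * t) \<and>
         (u t has_real_derivative c * v0' (Z 0)) (at x)))"
proof -
  have lam: "lam < 0" using neg by (simp add: lam_def)
  have sg: "\<bar>sg\<bar> = 1" using nonlin by (simp add: sg_def abs_sgn_eq)
  have shift: "((\<lambda>s. h (ubar + s)) has_real_derivative h' (ubar + s)) (at s)"
    if "\<And>x. (h has_real_derivative h' x) (at x)" for h h' :: "real \<Rightarrow> real" and s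
    using DERIV_chain2[OF that DERIV_add[OF DERIV_const DERIV_ident]] by simp
  obtain d0 m \<psi> where d0: "d0 > 0" and m: "continuous_on UNIV m"
    and m_ge: "\<And>s. 1 / \<kappa> \<le> m s" and m_le: "\<And>s. m s \<le> \<kappa>"
    and \<psi>0: "\<psi> 0 = 0" and \<psi>: "\<And>s. (\<psi> has_real_derivative m s) (at s)"
    and chart: "\<And>s. \<bar>s\<bar> \<le> d0 \<Longrightarrow> g (ubar + s) * m s = lam * \<psi> s"
  proof -
    have "(\<lambda>s. g (ubar + s)) 0 = 0" "(\<lambda>s. deriv g (ubar + s)) 0 < 0"
      using eq neg by simp_all
    from linearizing_coordinate[OF shift[OF C2_derivatives(1)[OF g]] shift[OF C2_derivatives(2)[OF g]] this \<kappa>]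
    show ?thesis using that by (auto simp: lam_def)
  qed
  have m_pos: "m s > 0" for s using m_ge[of s] \<kappa> by (smt (verit) divide_pos_pos)
  have f2: "continuous_on A (\<lambda>s. deriv (deriv f) (ubar + s))" for A
    by (rule continuous_on_compose2[OF C2_derivatives(3)[OF f]]) (auto intro: continuous_intros)
  obtain d1 where d1: "d1 > 0" "\<And>s. \<bar>s\<bar> \<le> d1 \<Longrightarrow> sg * deriv (deriv f) (ubar + s) \<in> {0<..}"
  proof (rule continuous_at_zero_interval)
    have "continuous_on UNIV (\<lambda>s. sg * deriv (deriv f) (ubar + s))"
      by (intro continuous_intros f2)
    then show "isCont (\<lambda>s. sg * deriv (deriv f) (ubar + s)) 0"
      by (simp add: continuous_on_eq_continuous_at)
    show "sg * deriv (deriv f) (ubar + 0) \<in> {0<..}"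
      using nonlin by (auto simp: sg_def sgn_if)
  qed auto
  define d where "d = min d0 d1"
  have d: "d > 0" "d \<le> d0" "d \<le> d1" using d0 d1 by (auto simp: d_def)
  define a' where "a' s = deriv (deriv f) (ubar + clip d s)" for s
  have a'_cont: "continuous_on UNIV a'"
    unfolding a'_def using continuous_on_compose_clip[OF f2] d(1) by simp
  have a'_nonneg: "0 \<le> sg * a' s" for s
    using d1(2)[of "clip d s"] clip_bounds[of d s] d by (simp add: a'_def)
  obtain M0 where M0: "\<And>s. sg * a' s \<le> M0" "M0 \<ge> 0"
  proof -
    have "bounded ((\<lambda>s. deriv (deriv f) (ubar + s)) ` {-d..d})"
      using f2 compact_continuous_image compact_imp_bounded compact_Icc by blast
    then obtain M0 where M0: "\<And>s. s \<in> {-d..d} \<Longrightarrow> \<bar>deriv (deriv f) (ubar + s)\<bar> \<le> M0"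
      unfolding bounded_iff real_norm_def by blast
    have "sg * a' s \<le> M0" for s
    proof -
      have "clip d s \<in> {-d..d}" using d(1) by (auto simp: clip_def)
      from M0[OF this] have "\<bar>sg * a' s\<bar> \<le> M0" by (simp add: a'_def abs_mult sg)
      then show ?thesis by simp
    qed
    moreover from this[of 0] a'_nonneg[of 0] have "M0 \<ge> 0" by linarith
    ultimately show ?thesis by (rule that)
  qed
  \<comment> \<open>The characteristic speed, equal to the derivative of f for states within d of ubar.\<close>
  obtain a where a0: "a 0 = deriv f ubar" and a: "\<And>s. (a has_real_derivative a' s) (at s)"
    using antiderivative_exists[OF a'_cont, of 0 "deriv f ubar"] by blast
  have a_eq: "a s = deriv f (ubar + s)" if "\<bar>s\<bar> \<le> d" for s
  proof -
    have "((\<lambda>s. a s - deriv f (ubar + s)) has_real_derivative 0) (at s within {-d..d})"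
      if "s \<in> {-d..d}" for s
    proof -
      have "((\<lambda>s. a s - deriv f (ubar + s)) has_real_derivative a' s - deriv (deriv f) (ubar + s)) (at s)"
        by (intro DERIV_diff a shift C2_derivatives(2)[OF f])
      moreover have "a' s = deriv (deriv f) (ubar + s)"
        using that by (simp add: a'_def clip_eq abs_le_iff)
      ultimately show ?thesis by (simp add: has_field_derivative_at_within)
    qed
    then obtain b where b: "\<And>s. s \<in> {-d..d} \<Longrightarrow> a s - deriv f (ubar + s) = b"
      using has_field_derivative_zero_constant[of "{-d..d}" "\<lambda>s. a s - deriv f (ubar + s)"] by auto
    show ?thesis using b[of s] b[of 0] that d(1) a0 by (auto simp: abs_le_iff)
  qed
  have \<psi>_bij: "bij \<psi>"
    by (rule bij_of_derivative_ge[OF \<psi> _ m_ge]) (use \<kappa> in simp)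
  define p where "p = inv \<psi>"
  have p_\<psi>: "p (\<psi> s) = s" and \<psi>_p: "\<psi> (p w) = w" for s w
    using \<psi>_bij by (simp_all add: p_def bij_is_surj surj_f_inv_f bij_is_inj inv_f_f)
  have \<psi>_ge: "\<bar>s\<bar> \<le> \<kappa> * \<bar>\<psi> s\<bar>" and \<psi>_le: "\<bar>\<psi> s\<bar> \<le> \<kappa> * \<bar>s\<bar>" for s
  proof -
    have minus: "((\<lambda>s. - \<psi> s) has_real_derivative - m s) (at s)" for s
      by (intro DERIV_minus \<psi>)
    have minus_ge: "- \<kappa> \<le> - m s" for s using m_le by simp
    \<comment> \<open>Upper bounds on growth come from the lower bound applied to the negated function.\<close>
    note lo = growth_of_derivative_ge[OF \<psi> m_ge]
    note hi = growth_of_derivative_ge[OF minus minus_ge]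
    have lower: "\<bar>s\<bar> / \<kappa> \<le> \<bar>\<psi> s\<bar>"
      using lo[of 0 s] lo[of s 0] \<psi>0 by (cases "s \<ge> 0") auto
    then show "\<bar>s\<bar> \<le> \<kappa> * \<bar>\<psi> s\<bar>" using \<kappa> by (simp add: field_simps)
    have "\<psi> s \<ge> 0" if "s \<ge> 0" using lo[of 0 s] that \<psi>0 \<kappa> by (simp add: order_trans[rotated])
    moreover have "\<psi> s \<le> 0" if "s \<le> 0"
    proof -
      have "0 \<le> 1 / \<kappa> * (0 - s)" using that \<kappa> by (intro mult_nonneg_nonneg) auto
      then show ?thesis using lo[of s 0] that \<psi>0 by linarith
    qed
    ultimately show "\<bar>\<psi> s\<bar> \<le> \<kappa> * \<bar>s\<bar>"
      using hi[of 0 s] hi[of s 0] \<psi>0 by (cases "s \<ge> 0") auto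
  qed
  have p: "(p has_real_derivative inverse (m (p w))) (at w)" for w
  proof (rule DERIV_inverse_function[where f = \<psi> and a = "w - 1" and b = "w + 1"])
    show "isCont p w"
      using isCont_inverse_function[of 1 "p w" p \<psi>] DERIV_isCont[OF \<psi>] by (simp add: p_\<psi> \<psi>_p)
    show "m (p w) \<noteq> 0" using m_pos[of "p w"] by simp
  qed (simp_all add: \<psi> \<psi>_p)
  have p_cont: "continuous_on UNIV p"
    using p DERIV_isCont continuous_at_imp_continuous_on by blast
  define F where "F w = a (p w)" for w
  define F' where "F' w = a' (p w) * inverse (m (p w))" for w
  define M where "M = M0 * \<kappa>"
  \<comment> \<open>With this choice the Jacobian of the characteristics costs at most one factor \<kappa>.\<close>
  define \<theta> where "\<theta> = 1 - 1 / \<kappa>"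
  have \<theta>: "0 < \<theta>" "\<theta> < 1" using \<kappa> by (simp_all add: \<theta>_def)
  have M: "M \<ge> 0" using M0 \<kappa> by (simp add: M_def)
  \<comment> \<open>The first bound keeps the states where the chart is valid, the second keeps the accumulated compression below \<theta>; adding 1 to the denominator covers M = 0.\<close>
  define \<epsilon> where "\<epsilon> = min (d / \<kappa>\<^sup>2) (- \<theta> * lam / (M * \<kappa> + 1))"
  have "0 < M * \<kappa> + 1" using M \<kappa> by (simp add: add_nonneg_pos)
  then have \<epsilon>: "\<epsilon> > 0" "\<kappa>\<^sup>2 * \<epsilon> \<le> d" "(M * \<kappa> + 1) * \<epsilon> \<le> - \<theta> * lam"
  proof -
    have "0 < - \<theta> * lam" using \<theta> lam by (simp add: mult_pos_neg)
    then have "0 < - \<theta> * lam / (M * \<kappa> + 1)" using \<open>0 < M * \<kappa> + 1\<close> by (rule divide_pos_pos)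
    moreover have "0 < d / \<kappa>\<^sup>2" using d(1) \<kappa> by simp
    ultimately show "\<epsilon> > 0" unfolding \<epsilon>_def min_less_iff_conj by blast
    have "\<kappa>\<^sup>2 * \<epsilon> \<le> \<kappa>\<^sup>2 * (d / \<kappa>\<^sup>2)" by (intro mult_left_mono) (auto simp: \<epsilon>_def)
    then show "\<kappa>\<^sup>2 * \<epsilon> \<le> d" using \<kappa> by simp
    have "(M * \<kappa> + 1) * \<epsilon> \<le> (M * \<kappa> + 1) * (- \<theta> * lam / (M * \<kappa> + 1))"
      by (rule mult_left_mono) (use \<open>0 < M * \<kappa> + 1\<close> in \<open>auto simp: \<epsilon>_def\<close>)
    then show "(M * \<kappa> + 1) * \<epsilon> \<le> - \<theta> * lam" using \<open>0 < M * \<kappa> + 1\<close> by simp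
  qed
  show ?thesis
  proof (intro exI[of _ \<epsilon>] conjI allI impI)
    fix v0 v0' :: "real \<Rightarrow> real"
    assume "\<forall>y. (v0 has_real_derivative v0' y) (at y)" and v0'_buc: "buc UNIV v0'"
      and "\<forall>y. \<bar>v0 y\<bar> \<le> \<epsilon>" and "\<forall>y. - \<epsilon> \<le> sg * v0' y"
    then have v0_deriv: "\<And>y. (v0 has_real_derivative v0' y) (at y)"
      and v0_small: "\<And>y. \<bar>v0 y\<bar> \<le> \<epsilon>" and v0'_ge: "\<And>y. - \<epsilon> \<le> sg * v0' y" by auto
    have v0_buc: "buc UNIV v0"
      unfolding buc_def
    proof
      show "bounded (range v0)" using v0_small by (auto simp: bounded_iff)
      show "uniformly_continuous_on UNIV v0"
        by (rule uniformly_continuous_on_bounded_derivative[of _ _ v0'])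
          (use v0_deriv v0'_buc in \<open>auto simp: buc_def\<close>)
    qed
    define w0 where "w0 y = \<psi> (v0 y)" for y
    define w0' where "w0' y = m (v0 y) * v0' y" for y
    interpret T: damped_transport F F' w0 w0' lam M sg \<theta>
    proof
      show "(F has_real_derivative F' w) (at w)" for w
        unfolding F_def F'_def by (rule DERIV_chain2[OF a p])
      have inv_m: "0 \<le> inverse (m (p w))" "inverse (m (p w)) \<le> \<kappa>" for w
        using m_pos[of "p w"] m_ge[of "p w"] \<kappa> by (auto simp: field_simps)
      show "0 \<le> sg * F' w" "sg * F' w \<le> M" for w
        unfolding F'_def M_def mult.assoc[symmetric]
        using a'_nonneg[of "p w"] M0 inv_m[of w]
        by (auto intro!: mult_nonneg_nonneg[of "sg * a' (p w)"] mult_mono[of "sg * a' (p w)"])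
      show "(w0 has_real_derivative w0' y) (at y)" for y
        unfolding w0_def w0'_def by (rule DERIV_chain2[OF \<psi> v0_deriv])
      have "continuous_on UNIV \<psi>"
        using \<psi> DERIV_isCont continuous_at_imp_continuous_on by blast
      then show "bounded (range w0)"
        using buc_compose[OF v0_buc] unfolding w0_def buc_def by blast
      show "buc UNIV w0'"
        unfolding w0'_def by (intro buc_mult v0'_buc buc_compose[OF v0_buc m])
      show "\<theta> * lam \<le> M * (sg * w0' y)" for y
      proof -
        have "- (\<kappa> * \<epsilon>) \<le> m (v0 y) * (sg * v0' y)"
        proof (cases "sg * v0' y \<ge> 0")
          case True
          then have "0 \<le> m (v0 y) * (sg * v0' y)"
            using m_pos[of "v0 y"] by (intro mult_nonneg_nonneg[of "m (v0 y)"]) auto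
          moreover have "0 \<le> \<kappa> * \<epsilon>" using \<kappa> \<epsilon>(1) by simp
          ultimately show ?thesis by linarith
        next
          case False
          have "\<kappa> * (- \<epsilon>) \<le> m (v0 y) * (- \<epsilon>)" using m_le[of "v0 y"] \<epsilon>(1) by simp
          also have "\<dots> \<le> m (v0 y) * (sg * v0' y)"
            using m_pos[of "v0 y"] v0'_ge[of y] by (intro mult_left_mono) auto
          finally show ?thesis by simp
        qed
        then have "M * - (\<kappa> * \<epsilon>) \<le> M * (m (v0 y) * (sg * v0' y))" using M by (rule mult_left_mono)
        moreover have "M * \<kappa> * \<epsilon> \<le> - \<theta> * lam" using \<epsilon>(1,3) by (simp add: algebra_simps)
        ultimately show ?thesis by (simp add: w0'_def algebra_simps)
      qed
    qed (use lam sg \<theta> in auto)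
    define v where "v t x = p (T.sol t x)" for t x
    define u where "u t x = ubar + v t x" for t x
    define ux where "ux t x = inverse (m (v t x)) * T.sol_x t x" for t x
    define ut where "ut t x = inverse (m (v t x)) * T.sol_t t x" for t x
    have flow_decay: "\<bar>p (exp (lam * s) * w0 y)\<bar> \<le> \<kappa>\<^sup>2 * exp (lam * s) * \<bar>v0 y\<bar>" for s y
    proof -
      have "\<bar>p (exp (lam * s) * w0 y)\<bar> \<le> \<kappa> * (exp (lam * s) * \<bar>w0 y\<bar>)"
        using \<psi>_ge[of "p (exp (lam * s) * w0 y)"] by (simp add: \<psi>_p abs_mult)
      also have "\<dots> \<le> \<kappa> * (exp (lam * s) * (\<kappa> * \<bar>v0 y\<bar>))"
        using \<psi>_le[of "v0 y"] \<kappa> by (intro mult_left_mono) (auto simp: w0_def)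
      finally show ?thesis by (simp add: power2_eq_square mult_ac)
    qed
    have flow_small: "\<bar>p (exp (lam * s) * w0 y)\<bar> \<le> d" if "s \<ge> 0" for s y
    proof -
      have "\<kappa>\<^sup>2 * exp (lam * s) * \<bar>v0 y\<bar> \<le> \<kappa>\<^sup>2 * 1 * \<epsilon>"
        using T.exp_decay[OF that] v0_small[of y] by (intro mult_mono) auto
      then show ?thesis using flow_decay[of s y] \<epsilon>(2) by simp
    qed
    have v_char: "v t x = p (exp (lam * t) * w0 (T.Y t x))" for t x
      by (simp add: v_def T.sol_def)
    have v_small: "\<bar>v t x\<bar> \<le> d" if "t \<ge> 0" for t x
      using flow_small[OF that] by (simp add: v_char)
    have u_derivative: "((\<lambda>z. u (fst z) (snd z)) has_derivative (\<lambda>d. ut t x * fst d + ux t x * snd d))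
        (at (t, x) within T.halfplane)" if "t \<ge> 0" for t x
    proof -
      have "((\<lambda>z. p (T.sol (fst z) (snd z))) has_derivative
          (\<lambda>d. (T.sol_t t x * fst d + T.sol_x t x * snd d) * inverse (m (v t x))))
          (at (t, x) within T.halfplane)"
        by (rule DERIV_compose_FDERIV[OF _ T.sol_derivative[OF that]]) (simp add: p v_def)
      then show ?thesis
        unfolding u_def v_def ux_def ut_def
        by (auto intro!: derivative_eq_intros simp: algebra_simps)
    qed
    have u_t: "((\<lambda>s. u s x) has_real_derivative ut t x) (at t within {0..})"
      and u_x: "(u t has_real_derivative ux t x) (at x)" if "t \<ge> 0" for t x
      using partial_derivatives_on_halfplane[OF u_derivative[OF that] that] by auto
    have v_buc: "buc T.halfplane (\<lambda>z. v (fst z) (snd z))"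
      unfolding v_def by (rule buc_compose[OF T.sol_buc(1) p_cont])
    have "continuous_on UNIV (\<lambda>s. inverse (m s))"
      using m_pos by (intro continuous_intros m) (metis less_irrefl)
    then have m_buc: "buc T.halfplane (\<lambda>z. inverse (m (v (fst z) (snd z))))"
      by (rule buc_compose[OF v_buc])
    have ux_buc: "buc T.halfplane (\<lambda>z. ux (fst z) (snd z))"
      unfolding ux_def by (rule buc_mult[OF m_buc T.sol_buc(2)])
    have BUC1: "BUC1 T.halfplane (\<lambda>z. u (fst z) (snd z))"
    proof (rule BUC1_planeI)
      show "buc T.halfplane (\<lambda>z. u (fst z) (snd z))"
        unfolding u_def by (intro buc_add buc_const v_buc)
      show "buc T.halfplane (\<lambda>z. ut (fst z) (snd z))"
        unfolding ut_def by (rule buc_mult[OF m_buc T.sol_buc(3)])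
    qed (use ux_buc u_derivative in auto)
    have pde: "ut t x + deriv f (u t x) * ux t x = g (u t x)" if "t \<ge> 0" for t x
    proof -
      have "F (T.sol t x) = deriv f (u t x)"
        using a_eq[OF v_small[OF that, of x]] by (simp add: F_def u_def v_def)
      then have "ut t x + deriv f (u t x) * ux t x = lam * \<psi> (v t x) * inverse (m (v t x))"
        by (simp add: ut_def ux_def T.sol_t_def v_def \<psi>_p algebra_simps)
      also have "\<dots> = g (u t x)"
        using chart[of "v t x"] v_small[OF that, of x] d m_pos[of "v t x"]
        by (simp add: u_def field_simps)
      finally show ?thesis .
    qed
    have solves: "global_classical_solution f g (\<lambda>x. ubar + v0 x) u"
      unfolding global_classical_solution_def
    proof (intro conjI allI impI)
      show "BUC1 ({0..} \<times> UNIV) (\<lambda>(t, x). u t x)"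
        using BUC1 by (simp add: case_prod_beta')
      show "u 0 x = ubar + v0 x" for x
        by (simp add: u_def v_def T.sol_initial w0_def p_\<psi>)
      show "\<exists>ut fx. ((\<lambda>s. u s x) has_real_derivative ut) (at t within {0..}) \<and>
          ((\<lambda>y. f (u t y)) has_real_derivative fx) (at x) \<and> ut + fx = g (u t x)"
        if "t \<ge> 0" for t x
        using u_t[OF that] DERIV_chain2[OF C2_derivatives(1)[OF f] u_x[OF that]] pde[OF that] by blast
    qed
    have deriv_cont: "continuous_on UNIV (deriv (u t))" if "t \<ge> 0" for t
    proof -
      have "deriv (u t) = ux t" using u_x[OF that] DERIV_imp_deriv by blast
      moreover have "continuous_on T.halfplane (\<lambda>z. ux (fst z) (snd z))"
        using ux_buc uniformly_continuous_imp_continuous by (auto simp: buc_def)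
      then have "continuous_on UNIV (\<lambda>x. (\<lambda>z. ux (fst z) (snd z)) (t, x))"
        by (rule continuous_on_compose2) (use that in \<open>auto intro!: continuous_intros\<close>)
      ultimately show ?thesis by simp
    qed
    show "\<exists>u. global_classical_solution f g (\<lambda>x. ubar + v0 x) u \<and>
      (\<forall>t\<ge>0. continuous_on UNIV (deriv (u t))) \<and>
      (\<forall>t\<ge>0. \<forall>x. \<exists>Z U c.
         bounded_characteristic f g Z U \<and> U 0 = ubar + v0 (Z 0) \<and> Z t = x \<and> U t = u t x \<and>
         \<bar>u t x - ubar\<bar> \<le> \<kappa> ^ 3 * exp (lam * t) * \<bar>v0 (Z 0)\<bar> \<and>
         0 \<le> c \<and> c \<le> \<kappa> ^ 3 * exp (lam * t) \<and>
         (u t has_real_derivative c * v0' (Z 0)) (at x))"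
    proof (intro exI[of _ u] conjI allI impI solves deriv_cont, assumption)
      fix t x :: real assume t: "t \<ge> 0"
      define y where "y = T.Y t x"
      define Z where "Z = (\<lambda>s. T.X s y)"
      define U where "U = (\<lambda>s. ubar + p (exp (lam * s) * w0 y))"
      define c where "c = exp (lam * t) * m (v0 y) * inverse (m (v t x)) * inverse (T.X_y t y)"
      have Z0: "Z 0 = y" by (simp add: Z_def T.X_def T.drift_def)
      have Z: "(Z has_real_derivative deriv f (U s)) (at s within {0..})" if "s \<ge> 0" for s
      proof -
        have "F (exp (lam * s) * w0 y) = deriv f (U s)"
          using a_eq[OF flow_small[OF that, of y]] by (simp add: F_def U_def)
        then show ?thesis
          using has_field_derivative_at_within[OF T.X_deriv_t[of y s]] by (simp add: Z_def)
      qed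
      have U: "(U has_real_derivative g (U s)) (at s within {0..})" if "s \<ge> 0" for s
      proof -
        let ?v = "p (exp (lam * s) * w0 y)"
        have "((\<lambda>s. exp (lam * s) * w0 y) has_real_derivative lam * (exp (lam * s) * w0 y)) (at s)"
          by (auto intro!: derivative_eq_intros)
        from DERIV_chain2[OF p this]
        have "(U has_real_derivative inverse (m ?v) * (lam * (exp (lam * s) * w0 y))) (at s)"
          unfolding U_def by (auto intro!: derivative_eq_intros)
        moreover have "inverse (m ?v) * (lam * (exp (lam * s) * w0 y)) = g (U s)"
          using chart[of ?v] flow_small[OF that, of y] d m_pos[of ?v]
          by (simp add: U_def \<psi>_p field_simps)
        ultimately show ?thesis by (simp add: has_field_derivative_at_within)
      qed
      have U_bounded: "bounded (U ` {0..})"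
      proof -
        have "\<bar>U s\<bar> \<le> \<bar>ubar\<bar> + d" if "s \<ge> 0" for s
          using flow_small[OF that, of y] by (simp add: U_def)
        then show ?thesis by (auto simp: bounded_iff)
      qed
      have ZU: "bounded_characteristic f g Z U"
        using Z U U_bounded by (simp add: bounded_characteristic_def)
      have X_y: "1 / \<kappa> \<le> T.X_y t y" using T.X_y_ge[OF t, of y] by (simp add: \<theta>_def)
      then have X_y_pos: "T.X_y t y > 0" using \<kappa> by (smt (verit) divide_pos_pos)
      have "inverse (T.X_y t y) \<le> \<kappa>" "inverse (m (v t x)) \<le> \<kappa>"
        using X_y X_y_pos m_ge[of "v t x"] m_pos[of "v t x"] \<kappa> by (simp_all add: field_simps)
      then have "c \<le> exp (lam * t) * \<kappa> * \<kappa> * \<kappa>"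
        unfolding c_def using m_le[of "v0 y"] m_pos[of "v0 y"] m_pos[of "v t x"] X_y_pos \<kappa>
        by (intro mult_mono) auto
      then have c_le: "c \<le> \<kappa> ^ 3 * exp (lam * t)" by (simp add: power3_eq_cube mult_ac)
      have c_ge: "0 \<le> c"
        unfolding c_def using m_pos X_y_pos by (simp add: less_imp_le)
      have "ux t x = c * v0' y"
        by (simp add: ux_def c_def T.sol_x_def w0'_def y_def divide_inverse mult_ac)
      then have u_deriv: "(u t has_real_derivative c * v0' y) (at x)" using u_x[OF t, of x] by simp
      have "\<bar>u t x - ubar\<bar> \<le> \<kappa>\<^sup>2 * exp (lam * t) * \<bar>v0 y\<bar>"
        using flow_decay[of t y] by (simp add: u_def v_char y_def)
      also have "\<dots> \<le> \<kappa> ^ 3 * exp (lam * t) * \<bar>v0 y\<bar>"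
        using \<kappa> by (intro mult_right_mono power_increasing) auto
      finally have decay: "\<bar>u t x - ubar\<bar> \<le> \<kappa> ^ 3 * exp (lam * t) * \<bar>v0 y\<bar>" .
      have "U 0 = ubar + v0 (Z 0)"
        unfolding Z0 by (simp add: U_def w0_def p_\<psi>)
      moreover have "Z t = x" "U t = u t x"
        using t by (simp_all add: U_def Z_def y_def T.X_Y u_def v_char)
      ultimately show "\<exists>Z U c.
         bounded_characteristic f g Z U \<and> U 0 = ubar + v0 (Z 0) \<and> Z t = x \<and> U t = u t x \<and>
         \<bar>u t x - ubar\<bar> \<le> \<kappa> ^ 3 * exp (lam * t) * \<bar>v0 (Z 0)\<bar> \<and>
         0 \<le> c \<and> c \<le> \<kappa> ^ 3 * exp (lam * t) \<and>
         (u t has_real_derivative c * v0' (Z 0)) (at x)"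
        using ZU decay c_ge c_le u_deriv unfolding Z0[symmetric]
        by (intro exI[of _ Z] exI[of _ U] exI[of _ c] conjI)
    qed
  qed (use \<epsilon>(1) in simp)
qed

theorem proposition1p3:
  fixes f g :: "real \<Rightarrow> real" and ubar :: real
  assumes "C2 f" and "C2 g"
    and "g ubar = 0" and "deriv g ubar < 0" and "deriv (deriv f) ubar \<noteq> 0"
  shows "\<forall>C0::real. C0 > 1 \<longrightarrow> (\<exists>\<epsilon>::real. \<epsilon> > 0 \<and>
    (\<forall>v0 :: real \<Rightarrow> real.
       BUC1 UNIV v0 \<and>
       Linf_norm v0 \<le> ereal \<epsilon> \<and>
       Linf_norm (\<lambda>x. neg_part (sgn (deriv (deriv f) ubar) * deriv v0 x)) \<le> ereal \<epsilon>
       \<longrightarrow>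
       (\<exists>u :: real \<Rightarrow> real \<Rightarrow> real.
          global_classical_solution f g (\<lambda>x. ubar + v0 x) u \<and>
          (\<forall>w. global_classical_solution f g (\<lambda>x. ubar + v0 x) w
                 \<longrightarrow> (\<forall>t\<ge>0. \<forall>x. w t x = u t x)) \<and>
          (\<forall>t\<ge>0.
             Linf_norm (\<lambda>x. u t x - ubar)
               \<le> Linf_norm v0 * ereal (C0 * exp (deriv g ubar * t)) \<and>
             Linf_norm (\<lambda>x. neg_part (sgn (deriv (deriv f) ubar) * deriv (u t) x))
               \<le> Linf_norm (\<lambda>x. neg_part (sgn (deriv (deriv f) ubar) * deriv v0 x))
                   * ereal (C0 * exp (deriv g ubar * t)) \<and>
             Linf_norm (\<lambda>x. deriv (u t) x)
               \<le> Linf_norm (\<lambda>x. deriv v0 x) * ereal (C0 * exp (deriv g ubar * t))))))"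
proof (intro allI impI)
  fix C0 :: real assume C0: "C0 > 1"
  let ?sg = "sgn (deriv (deriv f) ubar)"
  \<comment> \<open>The admissible loss C0 is shared by the three factors \<kappa>.\<close>
  define \<kappa> where "\<kappa> = root 3 C0"
  have \<kappa>: "\<kappa> > 1" "\<kappa> ^ 3 = C0" using C0 by (simp_all add: \<kappa>_def)
  have neg_part_cont: "continuous_on UNIV (\<lambda>x. neg_part (?sg * h x))"
    if "continuous_on UNIV h" for h :: "real \<Rightarrow> real"
    unfolding neg_part_def by (intro continuous_intros that)
  obtain \<epsilon> where \<epsilon>: "\<epsilon> > 0" and main: "\<forall>v0 v0'. (\<forall>y. (v0 has_real_derivative v0' y) (at y)) \<longrightarrow>
    buc UNIV v0' \<longrightarrow> (\<forall>y. \<bar>v0 y\<bar> \<le> \<epsilon>) \<longrightarrow> (\<forall>y. - \<epsilon> \<le> ?sg * v0' y) \<longrightarrow>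
    (\<exists>u. global_classical_solution f g (\<lambda>x. ubar + v0 x) u \<and>
      (\<forall>t\<ge>0. continuous_on UNIV (deriv (u t))) \<and>
      (\<forall>t\<ge>0. \<forall>x. \<exists>Z U c.
         bounded_characteristic f g Z U \<and> U 0 = ubar + v0 (Z 0) \<and> Z t = x \<and> U t = u t x \<and>
         \<bar>u t x - ubar\<bar> \<le> C0 * exp (deriv g ubar * t) * \<bar>v0 (Z 0)\<bar> \<and>
         0 \<le> c \<and> c \<le> C0 * exp (deriv g ubar * t) \<and>
         (u t has_real_derivative c * v0' (Z 0)) (at x)))"
    using solution_near_equilibrium[OF assms \<kappa>(1)] unfolding \<kappa>(2) by (elim exE conjE) (rule that)
  show "\<exists>\<epsilon>>0. \<forall>v0. BUC1 UNIV v0 \<and> Linf_norm v0 \<le> ereal \<epsilon> \<and>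
       Linf_norm (\<lambda>x. neg_part (?sg * deriv v0 x)) \<le> ereal \<epsilon> \<longrightarrow>
       (\<exists>u. global_classical_solution f g (\<lambda>x. ubar + v0 x) u \<and>
          (\<forall>w. global_classical_solution f g (\<lambda>x. ubar + v0 x) w
                 \<longrightarrow> (\<forall>t\<ge>0. \<forall>x. w t x = u t x)) \<and>
          (\<forall>t\<ge>0.
             Linf_norm (\<lambda>x. u t x - ubar)
               \<le> Linf_norm v0 * ereal (C0 * exp (deriv g ubar * t)) \<and>
             Linf_norm (\<lambda>x. neg_part (?sg * deriv (u t) x))
               \<le> Linf_norm (\<lambda>x. neg_part (?sg * deriv v0 x))
                   * ereal (C0 * exp (deriv g ubar * t)) \<and>
             Linf_norm (\<lambda>x. deriv (u t) x)
               \<le> Linf_norm (\<lambda>x. deriv v0 x) * ereal (C0 * exp (deriv g ubar * t))))"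
  proof (intro exI[of _ \<epsilon>] conjI allI impI \<epsilon>, elim conjE)
    fix v0 :: "real \<Rightarrow> real"
    assume BUC1: "BUC1 UNIV v0" and small: "Linf_norm v0 \<le> ereal \<epsilon>"
      and small': "Linf_norm (\<lambda>x. neg_part (?sg * deriv v0 x)) \<le> ereal \<epsilon>"
    note v0_deriv = BUC1_UNIV_derivative[OF BUC1]
    have v0_cont: "continuous_on UNIV v0"
      using v0_deriv(1) DERIV_isCont continuous_at_imp_continuous_on by blast
    have v0'_cont: "continuous_on UNIV (deriv v0)"
      using v0_deriv(2) uniformly_continuous_imp_continuous by (auto simp: buc_def)
    have v0_small: "\<bar>v0 y\<bar> \<le> \<epsilon>" for y
      using small Linf_norm_le_iff[OF v0_cont] by simp
    have v0'_ge: "- \<epsilon> \<le> ?sg * deriv v0 y" for y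
    proof -
      have "\<bar>neg_part (?sg * deriv v0 y)\<bar> \<le> \<epsilon>"
        using small' Linf_norm_le_iff[OF neg_part_cont[OF v0'_cont]] by simp
      then show ?thesis by (simp add: neg_part_def)
    qed
    obtain u where sol: "global_classical_solution f g (\<lambda>x. ubar + v0 x) u"
      and "\<forall>t\<ge>0. continuous_on UNIV (deriv (u t))"
      and "\<forall>t\<ge>0. \<forall>x. \<exists>Z U c.
         bounded_characteristic f g Z U \<and> U 0 = ubar + v0 (Z 0) \<and> Z t = x \<and> U t = u t x \<and>
         \<bar>u t x - ubar\<bar> \<le> C0 * exp (deriv g ubar * t) * \<bar>v0 (Z 0)\<bar> \<and>
         0 \<le> c \<and> c \<le> C0 * exp (deriv g ubar * t) \<and>
         (u t has_real_derivative c * deriv v0 (Z 0)) (at x)"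
      using main[rule_format, OF v0_deriv v0_small v0'_ge] by (elim exE conjE) (rule that)
    note u'_cont = this(2)[rule_format] and char = this(3)[rule_format]
    have unique: "w t x = u t x"
      if w: "global_classical_solution f g (\<lambda>x. ubar + v0 x) w" and t: "t \<ge> 0" for w t x
    proof -
      obtain Z U where ZU: "bounded_characteristic f g Z U" "U 0 = ubar + v0 (Z 0)"
        and terminal: "Z t = x" "U t = u t x"
        using char[OF t, of x] by (elim exE conjE) (rule that)
      show ?thesis
        using classical_solution_on_characteristic[OF assms(1,2) w ZU t] terminal by simp
    qed
    have estimates: "Linf_norm (\<lambda>x. u t x - ubar) \<le> Linf_norm v0 * ereal (C0 * exp (deriv g ubar * t))"
      "Linf_norm (\<lambda>x. neg_part (?sg * deriv (u t) x))
        \<le> Linf_norm (\<lambda>x. neg_part (?sg * deriv v0 x)) * ereal (C0 * exp (deriv g ubar * t))"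
      "Linf_norm (deriv (u t)) \<le> Linf_norm (deriv v0) * ereal (C0 * exp (deriv g ubar * t))"
      if t: "t \<ge> 0" for t
    proof -
      let ?C = "C0 * exp (deriv g ubar * t)"
      have C: "0 \<le> ?C" using C0 by simp
      have at_foot: "\<exists>y c. \<bar>u t x - ubar\<bar> \<le> ?C * \<bar>v0 y\<bar> \<and> 0 \<le> c \<and> c \<le> ?C \<and> deriv (u t) x = c * deriv v0 y"
        for x
      proof -
        obtain Z c where "\<bar>u t x - ubar\<bar> \<le> ?C * \<bar>v0 (Z 0)\<bar>" "0 \<le> c" "c \<le> ?C"
          and "(u t has_real_derivative c * deriv v0 (Z 0)) (at x)"
          using char[OF t, of x] by (elim exE conjE) (rule that)
        then show ?thesis using DERIV_imp_deriv by (intro exI[of _ "Z 0"] exI[of _ c]) simp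
      qed
      have "isCont (u t) x" for x
        using char[OF t, of x] by (elim exE conjE) (rule DERIV_isCont)
      then have "continuous_on UNIV (u t)"
        by (simp add: continuous_at_imp_continuous_on)
      then have "continuous_on UNIV (\<lambda>x. u t x - ubar)" by (intro continuous_intros)
      then show "Linf_norm (\<lambda>x. u t x - ubar) \<le> Linf_norm v0 * ereal ?C"
        by (rule Linf_norm_le_multiple[OF _ v0_cont C]) (use at_foot in blast)
      have "\<exists>y. \<bar>neg_part (?sg * deriv (u t) x)\<bar> \<le> ?C * \<bar>neg_part (?sg * deriv v0 y)\<bar>" for x
      proof -
        obtain y c where c: "0 \<le> c" "c \<le> ?C" "deriv (u t) x = c * deriv v0 y"
          using at_foot by blast
        have "neg_part (?sg * deriv (u t) x) = c * neg_part (?sg * deriv v0 y)"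
          using c(1) by (simp add: c(3) neg_part_def max_mult_distrib_left mult.left_commute)
        then show ?thesis using c(1,2)
          by (intro exI[of _ y]) (simp add: abs_mult mult_right_mono)
      qed
      then show "Linf_norm (\<lambda>x. neg_part (?sg * deriv (u t) x))
          \<le> Linf_norm (\<lambda>x. neg_part (?sg * deriv v0 x)) * ereal ?C"
        by (rule Linf_norm_le_multiple[OF neg_part_cont[OF u'_cont[OF t]] neg_part_cont[OF v0'_cont] C])
      have "\<exists>y. \<bar>deriv (u t) x\<bar> \<le> ?C * \<bar>deriv v0 y\<bar>" for x
      proof -
        obtain y c where c: "0 \<le> c" "c \<le> ?C" "deriv (u t) x = c * deriv v0 y"
          using at_foot by blast
        then show ?thesis by (intro exI[of _ y]) (simp add: abs_mult mult_right_mono)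
      qed
      then show "Linf_norm (deriv (u t)) \<le> Linf_norm (deriv v0) * ereal ?C"
        by (rule Linf_norm_le_multiple[OF u'_cont[OF t] v0'_cont C])
    qed
    show "\<exists>u. global_classical_solution f g (\<lambda>x. ubar + v0 x) u \<and>
          (\<forall>w. global_classical_solution f g (\<lambda>x. ubar + v0 x) w
                 \<longrightarrow> (\<forall>t\<ge>0. \<forall>x. w t x = u t x)) \<and>
          (\<forall>t\<ge>0.
             Linf_norm (\<lambda>x. u t x - ubar)
               \<le> Linf_norm v0 * ereal (C0 * exp (deriv g ubar * t)) \<and>
             Linf_norm (\<lambda>x. neg_part (?sg * deriv (u t) x))
               \<le> Linf_norm (\<lambda>x. neg_part (?sg * deriv v0 x))
                   * ereal (C0 * exp (deriv g ubar * t)) \<and>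
             Linf_norm (\<lambda>x. deriv (u t) x)
               \<le> Linf_norm (\<lambda>x. deriv v0 x) * ereal (C0 * exp (deriv g ubar * t)))"
      using sol unique estimates by (intro exI[of _ u] conjI allI impI)
  qed
qed

end
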